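(* For every real number $c>2$, the measure $\tau_c=e_c(t)\,dt$ on $(0,\infty)$ is S-indeterminate.
   Context: For $c>0$ the function $e_c:(0,\infty)\to\mathbb R$ is defined by $$e_c(t)=\frac{1}{2\pi}\int_{-\infty}^{\infty} t^{ix-1}\,\Gamma(1-ix)^c\,dx,\qquad t>0,$$ where $\Gamma(z)^c=\exp(c\log\Gamma(z))$ for $z\in\mathbb C\setminus(-\infty,0]$, and $\log\Gamma$ denotes the holomorphic branch on $\mathbb C\setminus(-\infty,0]$ of the logarithm of the (non-vanishing) function $\Gamma$ that equals $0$ at $z=1$. It is known that $e_c$ is a probability density on $(0,\infty)$ and that its moments are $\int_0^\infty t^n e_c(t)\,dt=(n!)^c$ for $n=0,1,2,\ldots$. A positive measure on the half-line $[0,\infty)$ with finite moments of all orders is called S-determinate (determinate in the sense of Stieltjes) if it is the only positive measure on $[0,\infty)$ having its moments, and S-indeterminate otherwise, i.e. if there is a different positive measure on $[0,\infty)$ with the same moments of all orders $n=0,1,2,\ldots$. *)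

theory Defs
  imports "HOL-Analysis.Analysis"
begin

text \<open>
  The library function \<^const>\<open>ln_Gamma\<close> on the complex numbers is the holomorphic branch of
  $\log\Gamma$ on the plane cut along the nonpositive reals that vanishes at \<open>1\<close>;
  it is not the principal logarithm of \<^const>\<open>Gamma\<close>.
\<close>

lemma ln_Gamma_branch:
  shows "(ln_Gamma :: complex \<Rightarrow> complex) holomorphic_on - \<real>\<^sub>\<le>\<^sub>0"
    and "\<And>z::complex. z \<notin> \<real>\<^sub>\<le>\<^sub>0 \<Longrightarrow> exp (ln_Gamma z) = Gamma z"
    and "ln_Gamma (1::complex) = 0"
proof -
  show "(ln_Gamma :: complex \<Rightarrow> complex) holomorphic_on - \<real>\<^sub>\<le>\<^sub>0"
    by (rule holomorphic_ln_Gamma) auto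
  show "exp (ln_Gamma z) = Gamma z" if "z \<notin> \<real>\<^sub>\<le>\<^sub>0" for z :: complex
    using that nonpos_Ints_subset_nonpos_Reals by (auto simp: Gamma_complex_altdef)
  show "ln_Gamma (1::complex) = 0"
    using ln_Gamma_complex_conv_fact[of 1] by simp
qed

definition Gamma_powr :: "complex \<Rightarrow> real \<Rightarrow> complex" where
  "Gamma_powr z c = exp (of_real c * ln_Gamma z)"

definition e_integrand :: "real \<Rightarrow> real \<Rightarrow> real \<Rightarrow> complex" where
  "e_integrand c t x =
     of_real t powr (\<i> * of_real x - 1) * Gamma_powr (1 - \<i> * of_real x) c"

text \<open>
  The real part only adjusts the type: \<open>of_real_e_fun\<close> below shows that the integral is real.
  The value is meaningful for \<open>t > 0\<close> only.
\<close>

definition e_fun :: "real \<Rightarrow> real \<Rightarrow> real" where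
  "e_fun c t = Re (1 / (2 * of_real pi) * (\<integral>x. e_integrand c t x \<partial>lborel))"

lemma cnj_ln_Gamma:
  assumes "z \<notin> \<real>\<^sub>\<le>\<^sub>0"
  shows "cnj (ln_Gamma z) = ln_Gamma (cnj z)"
proof -
  have nz: "w / of_nat k + 1 \<notin> \<real>\<^sub>\<le>\<^sub>0" if "w \<notin> \<real>\<^sub>\<le>\<^sub>0" "k \<ge> 1" for w :: complex and k :: nat
  proof
    assume "w / of_nat k + 1 \<in> \<real>\<^sub>\<le>\<^sub>0"
    hence "Re w / real k + 1 \<le> 0" "Im w = 0"
      using that(2) by (auto simp: complex_nonpos_Reals_iff)
    hence "Re w \<le> 0" using that(2) by (auto simp: field_simps)
    with \<open>Im w = 0\<close> that(1) show False by (simp add: complex_nonpos_Reals_iff)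
  qed
  have ser: "cnj (ln_Gamma_series z n) = ln_Gamma_series (cnj z) n" if "n \<ge> 1" for n
  proof -
    have "cnj (ln (of_nat n :: complex)) = ln (of_nat n)"
      using that by (subst cnj_Ln) (auto simp: complex_nonpos_Reals_iff)
    moreover have "cnj (\<Sum>k=1..n. ln (z / of_nat k + 1)) = (\<Sum>k=1..n. ln (cnj z / of_nat k + 1))"
      unfolding cnj_sum
    proof (rule sum.cong[OF refl])
      fix k assume "k \<in> {1..n}"
      hence "cnj (ln (z / of_nat k + 1)) = ln (cnj (z / of_nat k + 1))"
        using nz[OF assms, of k] by (intro cnj_Ln) auto
      thus "cnj (ln (z / of_nat k + 1)) = ln (cnj z / of_nat k + 1)" by simp
    qed
    ultimately show ?thesis
      using cnj_Ln[OF assms] by (simp add: ln_Gamma_series_def)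
  qed
  have z: "z \<notin> \<int>\<^sub>\<le>\<^sub>0" and cz: "cnj z \<notin> \<int>\<^sub>\<le>\<^sub>0"
    using assms nonpos_Ints_subset_nonpos_Reals by (auto simp: complex_nonpos_Reals_iff)
  have "(\<lambda>n. cnj (ln_Gamma_series z n)) \<longlonglongrightarrow> cnj (ln_Gamma z)"
    using ln_Gamma_complex_LIMSEQ[OF z] by (simp add: lim_cnj)
  moreover have "eventually (\<lambda>n. cnj (ln_Gamma_series z n) = ln_Gamma_series (cnj z) n) sequentially"
    using eventually_ge_at_top[of 1] by eventually_elim (rule ser)
  ultimately have "ln_Gamma_series (cnj z) \<longlonglongrightarrow> cnj (ln_Gamma z)"
    by (blast intro: Lim_transform_eventually)
  with ln_Gamma_complex_LIMSEQ[OF cz] show ?thesis by (blast intro: LIMSEQ_unique)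
qed

lemma cnj_e_integrand:
  assumes "t > 0"
  shows "cnj (e_integrand c t x) = e_integrand c t (- x)"
proof -
  have "1 - \<i> * of_real x \<notin> \<real>\<^sub>\<le>\<^sub>0" by (simp add: complex_nonpos_Reals_iff)
  moreover have "cnj (ln (complex_of_real t)) = ln (complex_of_real t)"
    using assms by (simp add: Ln_of_real)
  ultimately show ?thesis
    using assms by (simp add: e_integrand_def Gamma_powr_def exp_cnj cnj_ln_Gamma powr_def)
qed

lemma of_real_e_fun:
  assumes "t > 0"
  shows "complex_of_real (e_fun c t) = 1 / (2 * of_real pi) * (\<integral>x. e_integrand c t x \<partial>lborel)"
proof -
  have "(\<integral>x. e_integrand c t x \<partial>lborel) = (\<integral>x. e_integrand c t (- x) \<partial>lborel)"
    using lborel_integral_real_affine[of "-1" "e_integrand c t" 0] by simp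
  also have "\<dots> = cnj (\<integral>x. e_integrand c t x \<partial>lborel)"
    using assms by (simp flip: cnj_e_integrand)
  finally have "cnj (\<integral>x. e_integrand c t x \<partial>lborel) = (\<integral>x. e_integrand c t x \<partial>lborel)" ..
  hence "(\<integral>x. e_integrand c t x \<partial>lborel) \<in> \<real>"
    by (simp add: Reals_cnj_iff)
  then obtain r where "(\<integral>x. e_integrand c t x \<partial>lborel) = complex_of_real r"
    by (auto elim: Reals_cases)
  thus ?thesis by (simp add: e_fun_def)
qed

text \<open>The function \<open>e_fun c\<close> is nonnegative on the positive half-line, so that the
  truncation at \<open>0\<close> by \<^const>\<open>ennreal\<close> has no effect.\<close>

definition tau :: "real \<Rightarrow> real measure" where
  "tau c = density lborel (\<lambda>t. ennreal (indicator {0<..} t * e_fun c t))"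

text \<open>
  Measures on $[0,\infty)$ are represented as Borel measures on the real line that give
  no mass to the negative half-line.
\<close>

definition stieltjes_measure :: "real measure \<Rightarrow> bool" where
  "stieltjes_measure M \<longleftrightarrow>
     sets M = sets borel \<and> emeasure M {..<0} = 0 \<and> (\<forall>n::nat. integrable M (\<lambda>x. x ^ n))"

definition same_moments :: "real measure \<Rightarrow> real measure \<Rightarrow> bool" where
  "same_moments M N \<longleftrightarrow> (\<forall>n::nat. (\<integral>x. x ^ n \<partial>M) = (\<integral>x. x ^ n \<partial>N))"

definition S_determinate :: "real measure \<Rightarrow> bool" where
  "S_determinate M \<longleftrightarrow> stieltjes_measure M \<and>
     (\<forall>N. stieltjes_measure N \<and> same_moments M N \<longrightarrow> N = M)"

definition S_indeterminate :: "real measure \<Rightarrow> bool" where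
  "S_indeterminate M \<longleftrightarrow> stieltjes_measure M \<and>
     (\<exists>N. stieltjes_measure N \<and> same_moments M N \<and> N \<noteq> M)"

end

theory Submission
  imports Defs "HOL-Probability.Probability" "HOL-Complex_Analysis.Complex_Analysis"
begin

text \<open>
  For \<open>d = c - 1 > 0\<close>, Euler's limit formula for \<open>\<Gamma>\<close> exhibits \<open>l \<mapsto> \<Gamma>(1 + l)\<^sup>d\<close> as a limit of
  moment generating functions of sums of independent gamma variables, so it is the moment generating
  function of a probability law \<open>\<nu>\<close>. Analytic continuation and Fourier inversion then give
  \<open>e\<^sub>c(t) = \<integral> exp(-y) exp(-t exp(-y)) d\<nu>(y)\<close>, which yields nonnegativity, finite moments, and, because
  the moments of \<open>exp y\<close> are \<open>(n!)\<^sup>d\<close>, a lower bound \<open>e\<^sub>c(t) \<ge> A exp(-K t\<^bsup>1/c\<^esup>)\<close>.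
  If \<open>c > 2\<close>, take \<open>1/c < \<alpha> < 1/2\<close>. The function \<open>exp(-K t\<^sup>\<alpha>) sin(K tan(\<pi>\<alpha>) t\<^sup>\<alpha>)\<close> has vanishing moments
  and is dominated by a multiple of \<open>e\<^sub>c\<close>, so adding a small multiple of it to the density gives
  another positive measure with the same moments.
\<close>

section \<open>Laplace transforms on vertical strips\<close>

text \<open>Splitting one factor off Gamma^c concentrates the decay on the vertical line in that
  factor: Fourier inversion is applied to Gamma itself, whose original function is explicit, while
  Gamma^(c-1) enters only through a probability law. The obstacle is the lower bound, because the
  mixing law is known only through its exponential moments. The bound therefore has to come from
  comparing moments, and the exponent 1/c is the outcome of a balance: keeping the mixture
  components with exp y at least of order n^(c-1) costs about t / n^(c-1) in the exponent, the
  moments of order n and 2 n + 1 cost a factor exponential in n, and the two costs agree when n is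
  of order t^(1/c). The upper limit 1/2 for \<alpha> comes from the other side: the oscillating
  function is built from exp(-w t^\<alpha>) with w of argument pi \<alpha>, and it decays only while
  w stays in the open right half-plane. An \<alpha> between 1/c and 1/2 exists exactly when c >
  2.\<close>

lemma integrable_exp_cmult:
  fixes M :: "real measure" and z :: complex
  assumes M [measurable_cong]: "sets M = sets borel"
    and "integrable M (\<lambda>y. exp (Re z * y))"
  shows "integrable M (\<lambda>y. exp (z * complex_of_real y))"
  by (rule Bochner_Integration.integrable_bound[OF assms(2)]) auto

text \<open>Along the segment from z to w the derivative is at most |y| exp(Re z y + r |y|). The
  factor |y| is absorbed by exp(r |y|) / r, and the resulting exp(2 r |y|) by the sum over both
  signs. Since the bound is uniform in w, it can serve as the dominating function when
  differentiating under the integral.\<close>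

lemma exp_quotient_bound:
  fixes z w :: complex and y r :: real
  assumes "r > 0" "w \<in> ball z r" "w \<noteq> z"
  shows "norm ((exp (w * of_real y) - exp (z * of_real y)) / (w - z))
         \<le> (exp ((Re z + 2 * r) * y) + exp ((Re z - 2 * r) * y)) / r"
proof -
  have 1: "norm (exp (w * of_real y) - exp (z * of_real y)) \<le> \<bar>y\<bar> * exp (Re z * y + r * \<bar>y\<bar>) * norm (w - z)"
  proof (rule field_differentiable_bound[of "ball z r" "\<lambda>w. exp (w * of_real y)" "\<lambda>w. exp (w * of_real y) * of_real y"])
    fix u assume "u \<in> ball z r"
    hence "\<bar>Re (u - z)\<bar> < r"
      using abs_Re_le_cmod[of "u - z"] by (simp add: dist_norm norm_minus_commute)
    hence "\<bar>Re (u - z) * y\<bar> \<le> r * \<bar>y\<bar>"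
      by (simp add: abs_mult mult_right_mono)
    moreover have "Re u * y = Re z * y + Re (u - z) * y"
      by (simp add: algebra_simps)
    ultimately have "Re u * y \<le> Re z * y + r * \<bar>y\<bar>"
      by linarith
    thus "norm (exp (u * of_real y) * of_real y) \<le> \<bar>y\<bar> * exp (Re z * y + r * \<bar>y\<bar>)"
      by (simp add: norm_mult mult.commute mult_left_mono)
  qed (use assms in \<open>auto intro!: derivative_eq_intros\<close>)
  have "\<bar>y\<bar> \<le> exp (r * \<bar>y\<bar>) / r"
    using exp_ge_add_one_self[of "r * \<bar>y\<bar>"] \<open>r > 0\<close>
    by (simp add: pos_le_divide_eq mult.commute del: exp_ge_add_one_self)
  hence "\<bar>y\<bar> * exp (Re z * y + r * \<bar>y\<bar>) \<le> exp (r * \<bar>y\<bar>) / r * exp (Re z * y + r * \<bar>y\<bar>)"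
    by (rule mult_right_mono) simp
  also have "\<dots> = exp (Re z * y + 2 * r * \<bar>y\<bar>) / r"
    by (simp add: field_simps flip: exp_add)
  also have "exp (Re z * y + 2 * r * \<bar>y\<bar>) \<le> exp ((Re z + 2 * r) * y) + exp ((Re z - 2 * r) * y)"
    by (cases "y \<ge> 0") (simp_all add: algebra_simps)
  hence "exp (Re z * y + 2 * r * \<bar>y\<bar>) / r \<le> (exp ((Re z + 2 * r) * y) + exp ((Re z - 2 * r) * y)) / r"
    using \<open>r > 0\<close> by (simp add: divide_right_mono)
  finally have 2: "\<bar>y\<bar> * exp (Re z * y + r * \<bar>y\<bar>) \<le> (exp ((Re z + 2 * r) * y) + exp ((Re z - 2 * r) * y)) / r" .
  have "norm ((exp (w * of_real y) - exp (z * of_real y)) / (w - z)) \<le> \<bar>y\<bar> * exp (Re z * y + r * \<bar>y\<bar>)"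
    using 1 assms(3) by (simp add: norm_divide field_simps)
  with 2 show ?thesis by linarith
qed

lemma laplace_transform_holomorphic:
  fixes M :: "real measure" and a b :: real
  assumes M [measurable_cong]: "sets M = sets borel"
    and int: "\<And>l. a < l \<Longrightarrow> l < b \<Longrightarrow> integrable M (\<lambda>y. exp (l * y))"
  shows "(\<lambda>z. \<integral>y. exp (z * complex_of_real y) \<partial>M) holomorphic_on {z. a < Re z \<and> Re z < b}"
proof (unfold holomorphic_on_def, safe)
  fix z :: complex
  assume z: "a < Re z" "Re z < b"
  \<comment> \<open>A third of the distance to the boundary keeps both exponents
    \<open>Re z + 2 * r\<close> and \<open>Re z - 2 * r\<close> of the dominating function inside
    the strip.\<close>
  define r where "r = min (Re z - a) (b - Re z) / 3"
  have r: "r > 0" "a < Re z - 2 * r" "Re z + 2 * r < b"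
    using z by (auto simp: r_def min_def field_simps)
  define F where "F = (\<lambda>z. \<integral>y. exp (z * complex_of_real y) \<partial>M)"
  have intz: "integrable M (\<lambda>y. exp (w * complex_of_real y))" if "w \<in> ball z r" for w
  proof (rule integrable_exp_cmult[OF M int])
    have "\<bar>Re (w - z)\<bar> < r"
      using abs_Re_le_cmod[of "w - z"] that by (simp add: dist_norm norm_minus_commute)
    thus "a < Re w" "Re w < b" using r by auto
  qed
  have "((\<lambda>w. (F w - F z) / (w - z)) \<longlongrightarrow> (\<integral>y. exp (z * of_real y) * of_real y \<partial>M)) (at z within ball z r)"
    unfolding tendsto_at_iff_sequentially
  proof (intro allI impI)
    fix X assume X: "\<forall>i. X i \<in> ball z r - {z}" "X \<longlonglongrightarrow> z"
    let ?q = "\<lambda>w y. (exp (w * of_real y) - exp (z * of_real y)) / (w - z)"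
    have "(\<lambda>i. \<integral>y. ?q (X i) y \<partial>M) \<longlonglongrightarrow> (\<integral>y. exp (z * of_real y) * of_real y \<partial>M)"
    proof (rule integral_dominated_convergence)
      show "integrable M (\<lambda>y. (exp ((Re z + 2 * r) * y) + exp ((Re z - 2 * r) * y)) / r)"
        using r by (intro integrable_divide Bochner_Integration.integrable_add int) auto
      show "AE y in M. norm (?q (X i) y) \<le> (exp ((Re z + 2 * r) * y) + exp ((Re z - 2 * r) * y)) / r" for i
        using X(1) r(1) by (intro always_eventually allI exp_quotient_bound) auto
      show "AE y in M. (\<lambda>i. ?q (X i) y) \<longlonglongrightarrow> exp (z * of_real y) * of_real y"
      proof (intro always_eventually allI)
        fix y :: real
        have "((\<lambda>w. exp (w * of_real y)) has_field_derivative (exp (z * of_real y) * of_real y)) (at z)"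
          by (auto intro!: derivative_eq_intros)
        hence "((\<lambda>w. ?q w y) \<longlongrightarrow> exp (z * of_real y) * of_real y) (at z)"
          by (simp add: has_field_derivative_iff)
        thus "(\<lambda>i. ?q (X i) y) \<longlonglongrightarrow> exp (z * of_real y) * of_real y"
          by (rule filterlim_compose) (use X in \<open>auto simp: filterlim_at\<close>)
      qed
    qed measurable
    moreover have "(\<lambda>i. \<integral>y. ?q (X i) y \<partial>M) = (\<lambda>i. (F (X i) - F z) / (X i - z))"
      unfolding F_def using X(1) r(1) intz by (intro ext) simp
    ultimately show "((\<lambda>w. (F w - F z) / (w - z)) \<circ> X) \<longlonglongrightarrow> (\<integral>y. exp (z * of_real y) * of_real y \<partial>M)"
      by (simp only: o_def)
  qed
  hence "(F has_field_derivative (\<integral>y. exp (z * of_real y) * of_real y \<partial>M)) (at z)"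
    using r(1) unfolding has_field_derivative_iff by (subst (asm) at_within_open) auto
  thus "F field_differentiable at z within {z. a < Re z \<and> Re z < b}"
    using field_differentiable_at_within field_differentiable_def by blast
qed

text \<open>Both sides are holomorphic on the strip and agree on a real segment, which accumulates
  inside it. The complex evaluations below all take this form: a formula established for real
  exponents is continued to Gamma, to its power with exponent d, and to a complex power.\<close>

lemma laplace_transform_eqI:
  fixes M :: "real measure" and a b :: real and F :: "complex \<Rightarrow> complex"
  assumes M: "sets M = sets borel"
    and int: "\<And>l. a < l \<Longrightarrow> l < b \<Longrightarrow> integrable M (\<lambda>y. exp (l * y))"
    and eq: "\<And>l. a < l \<Longrightarrow> l < b \<Longrightarrow> complex_of_real (\<integral>y. exp (l * y) \<partial>M) = F (of_real l)"
    and F: "F holomorphic_on {z. a < Re z \<and> Re z < b}"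
    and z: "a < Re z" "Re z < b"
  shows "(\<integral>y. exp (z * complex_of_real y) \<partial>M) = F z"
proof -
  define S where "S = {z. a < Re z \<and> Re z < b}"
  define m where "m = (a + b) / 2"
  have m: "a < m" "m < b" using z by (auto simp: m_def)
  have S: "S = {z. Re z > a} \<inter> {z. Re z < b}" by (auto simp: S_def)
  have "(\<integral>y. exp (z * complex_of_real y) \<partial>M) - F z = 0"
  proof (rule analytic_continuation[of "\<lambda>z. (\<integral>y. exp (z * complex_of_real y) \<partial>M) - F z" S "of_real ` {a<..<b}" "of_real m"])
    show "(\<lambda>z. (\<integral>y. exp (z * complex_of_real y) \<partial>M) - F z) holomorphic_on S"
      using laplace_transform_holomorphic[OF M int] F unfolding S_def by (intro holomorphic_intros) auto
    show "open S" unfolding S by (intro open_Int open_halfspace_Re_gt open_halfspace_Re_lt)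
    show "connected S" unfolding S
      by (intro convex_connected convex_Int convex_halfspace_Re_gt convex_halfspace_Re_lt)
    show "complex_of_real m islimpt of_real ` {a<..<b}"
    proof (unfold islimpt_approachable, safe)
      fix e :: real assume "e > 0"
      define x where "x = m + min (e / 2) ((b - m) / 2)"
      have "m < x" "x < b" "x - m < e" using m \<open>e > 0\<close> by (auto simp: x_def min_def field_simps)
      thus "\<exists>x'\<in>of_real ` {a<..<b}. x' \<noteq> complex_of_real m \<and> dist x' (complex_of_real m) < e"
        using m by (intro bexI[of _ "of_real x"]) (auto simp: dist_of_real dist_real_def)
    qed
    fix w assume "w \<in> complex_of_real ` {a<..<b}"
    then obtain l where l: "w = of_real l" "a < l" "l < b" by auto
    have "(\<integral>y. exp (w * complex_of_real y) \<partial>M) = (\<integral>y. complex_of_real (exp (l * y)) \<partial>M)"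
      by (simp add: l(1) exp_of_real flip: of_real_mult)
    also have "\<dots> = F w" using eq[OF l(2,3)] by (simp add: l(1))
    finally show "(\<integral>y. exp (w * complex_of_real y) \<partial>M) - F w = 0" by simp
  qed (use m z in \<open>auto simp: S_def\<close>)
  thus ?thesis by simp
qed

section \<open>Laws with moment generating function a power of $\Gamma$\<close>

lemma nn_integral_powr_exp:
  fixes s a :: real
  assumes "s > 0" "a > 0"
  shows "(\<integral>\<^sup>+t. ennreal (indicator {0..} t * t powr (s - 1) * exp (- (a * t))) \<partial>lborel) = ennreal (Gamma s * a powr (- s))"
proof -
  let ?I = "\<integral>\<^sup>+t. ennreal (indicator {0..} t * t powr (s - 1) * exp (- (a * t))) \<partial>lborel"
  have "ennreal (Gamma s) = (\<integral>\<^sup>+t. ennreal (indicator {0..} t * t powr (s - 1) / exp t) \<partial>lborel)"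
    by (rule Gamma_conv_nn_integral_real[OF assms(1)])
  also have "\<dots> = ennreal a * (\<integral>\<^sup>+t. ennreal (indicator {0..} (0 + a * t) * (0 + a * t) powr (s - 1) / exp (0 + a * t)) \<partial>lborel)"
    using assms by (subst nn_integral_real_affine[where c = a and t = 0]) auto
  also have "(\<integral>\<^sup>+t. ennreal (indicator {0..} (0 + a * t) * (0 + a * t) powr (s - 1) / exp (0 + a * t)) \<partial>lborel)
      = (\<integral>\<^sup>+t. ennreal (a powr (s - 1)) * ennreal (indicator {0..} t * t powr (s - 1) * exp (- (a * t))) \<partial>lborel)"
    using assms by (intro nn_integral_cong)
      (auto simp: powr_mult exp_minus divide_inverse zero_le_mult_iff mult_ac
            split: split_indicator simp flip: ennreal_mult)
  also have "\<dots> = ennreal (a powr (s - 1)) * ?I"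
    by (rule nn_integral_cmult) measurable
  finally have "ennreal (Gamma s) = ennreal (a powr s) * ?I"
    using assms by (simp add: powr_diff flip: mult.assoc ennreal_mult)
  hence "ennreal (a powr (- s)) * ennreal (Gamma s) = ennreal (a powr (- s)) * (ennreal (a powr s) * ?I)"
    by simp
  also have "\<dots> = ?I"
    using assms by (simp flip: mult.assoc ennreal_mult powr_add)
  finally show ?thesis
    using assms by (simp add: mult.commute Gamma_real_pos less_imp_le flip: ennreal_mult)
qed

text \<open>The witness is the law of -T/k, where T is gamma distributed with shape d and rate 1.
  Its transform (1 + l/k)^(-d) is the d-th power of one factor of Euler's product.\<close>

lemma neg_gamma_distribution:
  fixes d k :: real
  assumes "d > 0" "k > 0"
  obtains N where "real_distribution N"
    "\<And>l. l > - k \<Longrightarrow> (\<integral>\<^sup>+y. ennreal (exp (l * y)) \<partial>N) = ennreal ((k / (k + l)) powr d)"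
proof -
  define f :: "real \<Rightarrow> real" where "f = (\<lambda>t. indicator {0..} t * t powr (d - 1) * exp (- t) / Gamma d)"
  have [measurable]: "f \<in> borel_measurable borel" by (simp add: f_def)
  have G: "Gamma d > 0" using assms by (simp add: Gamma_real_pos)
  define N where "N = distr (density lborel (\<lambda>t. ennreal (f t))) borel (\<lambda>t. - t / k)"
  have N: "(\<integral>\<^sup>+y. ennreal (exp (l * y)) \<partial>N) = ennreal ((k / (k + l)) powr d)" if l: "l > - k" for l
  proof -
    have "(\<integral>\<^sup>+y. ennreal (exp (l * y)) \<partial>N) = (\<integral>\<^sup>+t. ennreal (f t) * ennreal (exp (l * (- t / k))) \<partial>lborel)"
      unfolding N_def by (simp add: nn_integral_distr nn_integral_density)
    also have "\<dots> = (\<integral>\<^sup>+t. ennreal (1 / Gamma d) * ennreal (indicator {0..} t * t powr (d - 1) * exp (- ((1 + l / k) * t))) \<partial>lborel)"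
      using G assms by (intro nn_integral_cong)
        (auto simp: f_def ring_distribs mult_exp_exp split: split_indicator simp flip: ennreal_mult)
    also have "\<dots> = ennreal (1 / Gamma d) * ennreal (Gamma d * (1 + l / k) powr (- d))"
      using assms l by (subst nn_integral_cmult, measurable) (subst nn_integral_powr_exp, auto simp: field_simps)
    also have "\<dots> = ennreal ((1 + l / k) powr (- d))"
      using G by (simp flip: ennreal_mult)
    also have "1 + l / k = inverse (k / (k + l))"
      using assms l by (simp add: field_simps)
    also have "inverse (k / (k + l)) powr (- d) = (k / (k + l)) powr d"
      using assms l by (simp add: powr_minus powr_divide field_simps)
    finally show ?thesis .
  qed
  have "emeasure N UNIV = (\<integral>\<^sup>+y. ennreal (exp (0 * y)) \<partial>N)"
    by (simp add: N_def)
  also have "\<dots> = 1" using assms by (subst N) auto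
  finally have "prob_space N" by (intro prob_spaceI) (simp add: N_def)
  hence "real_distribution N"
    by (simp add: real_distribution_def real_distribution_axioms_def N_def)
  with N show ?thesis using that by blast
qed

text \<open>Convolution multiplies transforms, so each induction step adds an independent variable
  with transform the d-th power of (m+1)/(m+1+l), the quotient of consecutive terms. Among all
  factors the one with k = 1 has the smallest range of finiteness, which gives l > -1.\<close>

lemma Gamma_product_distribution_aux:
  fixes d :: real
  assumes "d > 0"
  shows "\<exists>M. real_distribution M \<and>
    (\<forall>l>-1. (\<integral>\<^sup>+y. ennreal (exp (l * y)) \<partial>M) = ennreal ((fact m / pochhammer (1 + l) m) powr d))"
proof (induction m)
  case 0
  have "real_distribution (return borel (0::real))"
    by (simp add: real_distribution_def real_distribution_axioms_def prob_space_return)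
  moreover have "(\<integral>\<^sup>+y. ennreal (exp (l * y)) \<partial>return borel 0) = 1" for l :: real
    by (simp add: nn_integral_return)
  ultimately show ?case by (intro exI[of _ "return borel 0"]) auto
next
  case (Suc m)
  then obtain M where M: "real_distribution M"
    "\<And>l. l > -1 \<Longrightarrow> (\<integral>\<^sup>+y. ennreal (exp (l * y)) \<partial>M) = ennreal ((fact m / pochhammer (1 + l) m) powr d)"
    by blast
  obtain N where N: "real_distribution N"
    "\<And>l. l > - real (Suc m) \<Longrightarrow> (\<integral>\<^sup>+y. ennreal (exp (l * y)) \<partial>N) = ennreal ((real (Suc m) / (real (Suc m) + l)) powr d)"
    using neg_gamma_distribution[of d "real (Suc m)"] assms by auto
  interpret M: real_distribution M by fact
  interpret N: real_distribution N by fact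
  have *: "(\<integral>\<^sup>+y. ennreal (exp (l * y)) \<partial>(M \<star> N)) = ennreal ((fact (Suc m) / pochhammer (1 + l) (Suc m)) powr d)"
    if "l > -1" for l
  proof -
    have [measurable]: "(\<lambda>x. ennreal (exp (l * x))) \<in> borel_measurable N"
      "(\<lambda>x. ennreal (exp (l * x))) \<in> borel_measurable M" by measurable
    have "(\<integral>\<^sup>+y. ennreal (exp (l * y)) \<partial>(M \<star> N)) = (\<integral>\<^sup>+x. \<integral>\<^sup>+y. ennreal (exp (l * (x + y))) \<partial>N \<partial>M)"
      by (rule nn_integral_convolution) (auto intro: M.finite_measure_axioms N.finite_measure_axioms)
    also have "\<dots> = (\<integral>\<^sup>+x. \<integral>\<^sup>+y. ennreal (exp (l * x)) * ennreal (exp (l * y)) \<partial>N \<partial>M)"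
      by (simp add: ring_distribs exp_add ennreal_mult)
    also have "\<dots> = (\<integral>\<^sup>+x. ennreal (exp (l * x)) * (\<integral>\<^sup>+y. ennreal (exp (l * y)) \<partial>N) \<partial>M)"
      by (subst nn_integral_cmult) auto
    also have "\<dots> = (\<integral>\<^sup>+x. ennreal (exp (l * x)) \<partial>M) * (\<integral>\<^sup>+y. ennreal (exp (l * y)) \<partial>N)"
      by (rule nn_integral_multc) auto
    also have "\<dots> = ennreal ((fact m / pochhammer (1 + l) m) powr d * (real (Suc m) / (real (Suc m) + l)) powr d)"
      using that by (subst M(2), simp, subst N(2)) (auto simp: ennreal_mult)
    also have "(fact m / pochhammer (1 + l) m) powr d * (real (Suc m) / (real (Suc m) + l)) powr d
        = (fact (Suc m) / pochhammer (1 + l) (Suc m)) powr d"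
      using that pochhammer_pos[of "1 + l" m]
      by (subst powr_mult [symmetric]) (auto simp: pochhammer_Suc algebra_simps)
    finally show ?thesis .
  qed
  have "emeasure (M \<star> N) UNIV = (\<integral>\<^sup>+y. ennreal (exp (0 * y)) \<partial>(M \<star> N))" by simp
  also have "\<dots> = 1" by (subst *) (auto simp: pochhammer_fact[symmetric])
  finally have "prob_space (M \<star> N)" by (intro prob_spaceI) simp
  hence "real_distribution (M \<star> N)"
    by (simp add: real_distribution_def real_distribution_axioms_def)
  with * show ?case by blast
qed

lemma Gamma_product_distribution:
  fixes d :: real
  assumes "d > 0" "m > 0"
  obtains M where "real_distribution M"
    "\<And>l. l > -1 \<Longrightarrow> (\<integral>\<^sup>+y. ennreal (exp (l * y)) \<partial>M) = ennreal (Gamma_series' (1 + l) m powr d)"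
proof -
  obtain M where M: "real_distribution M"
    "\<And>l. l > -1 \<Longrightarrow> (\<integral>\<^sup>+y. ennreal (exp (l * y)) \<partial>M) = ennreal ((fact m / pochhammer (1 + l) m) powr d)"
    using Gamma_product_distribution_aux[OF assms(1)] by blast
  interpret M: real_distribution M by fact
  \<comment> \<open>Translation by d ln m multiplies the transform by m^(l d), which is the power of
    m in Euler's formula.\<close>
  let ?N = "distr M borel (\<lambda>y. y + d * ln (real m))"
  have "real_distribution ?N"
    by (simp add: real_distribution_def real_distribution_axioms_def M.prob_space_distr)
  moreover have "(\<integral>\<^sup>+y. ennreal (exp (l * y)) \<partial>?N) = ennreal (Gamma_series' (1 + l) m powr d)" if l: "l > -1" for l
  proof -
    have p: "pochhammer (1 + l) m > 0" using l by (intro pochhammer_pos) auto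
    have "(\<integral>\<^sup>+y. ennreal (exp (l * y)) \<partial>?N) = (\<integral>\<^sup>+y. ennreal (exp (l * d * ln (real m))) * ennreal (exp (l * y)) \<partial>M)"
      by (subst nn_integral_distr) (auto simp: ring_distribs exp_add ennreal_mult mult_ac)
    also have "\<dots> = ennreal (exp (l * d * ln (real m))) * ennreal ((fact m / pochhammer (1 + l) m) powr d)"
      using l by (subst nn_integral_cmult) (auto simp: M(2))
    also have "\<dots> = ennreal (exp (l * d * ln (real m)) * (fact m / pochhammer (1 + l) m) powr d)"
      by (simp add: ennreal_mult)
    also have "exp (l * d * ln (real m)) = (real m powr l) powr d"
      using assms by (simp add: powr_def powr_powr mult_ac)
    also have "(real m powr l) powr d * (fact m / pochhammer (1 + l) m) powr d = (real m powr l * (fact m / pochhammer (1 + l) m)) powr d"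
      using p by (subst powr_mult [symmetric]) auto
    also have "real m powr l * (fact m / pochhammer (1 + l) m) = Gamma_series' (1 + l) m"
      using assms by (simp add: Gamma_series'_def powr_def ring_distribs exp_add fact_reduce)
    finally show ?thesis .
  qed
  ultimately show ?thesis using that by blast
qed

section \<open>Tightness and weak limits of exponential moments\<close>

lemma tight_if_exp_moments_bounded:
  fixes \<mu> :: "nat \<Rightarrow> real measure" and B :: real
  assumes dist: "\<And>n. real_distribution (\<mu> n)"
    and "a > 0" "b > 0"
    and int: "\<And>n. integrable (\<mu> n) (\<lambda>y. exp (a * y))" "\<And>n. integrable (\<mu> n) (\<lambda>y. exp (- b * y))"
    and le: "\<And>n. (\<integral>y. exp (a * y) \<partial>\<mu> n) \<le> B" "\<And>n. (\<integral>y. exp (- b * y) \<partial>\<mu> n) \<le> B"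
  shows "tight \<mu>"
  unfolding tight_def
proof (intro conjI allI impI)
  fix \<epsilon> :: real assume "\<epsilon> > 0"
  have "0 \<le> (\<integral>y. exp (a * y) \<partial>\<mu> 0)" by simp
  with le(1)[of 0] have B: "B \<ge> 0" by linarith
  \<comment> \<open>Chernoff bounds at \<open>R / a\<close> and \<open>- R / b\<close> give each
    tail mass at most exp(-R) B, so R has to satisfy 2 B exp(-R) < \<epsilon>. The
    \<open>+ 1\<close> makes this strict, and the maximum with 1 makes the interval
    nonempty.\<close>
  define R where "R = max 1 (ln ((2 * B + 1) / \<epsilon>))"
  have R: "R > 0" by (simp add: R_def)
  have "(2 * B + 1) / \<epsilon> = exp (ln ((2 * B + 1) / \<epsilon>))" using B \<open>\<epsilon> > 0\<close> by simp
  also have "\<dots> \<le> exp R" by (simp add: R_def)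
  finally have "exp (- R) * (2 * B + 1) \<le> \<epsilon>"
    using \<open>\<epsilon> > 0\<close> by (simp add: exp_minus field_simps)
  moreover have "exp (- R) * (2 * B) < exp (- R) * (2 * B + 1)" by simp
  ultimately have R2: "exp (- R) * (2 * B) < \<epsilon>" by linarith
  show "\<exists>x y. x < y \<and> (\<forall>n. 1 - \<epsilon> < measure (\<mu> n) {x<..y})"
  proof (intro exI conjI allI)
    have "- R / b < 0" "0 < R / a" using R assms by auto
    thus "- R / b < R / a" by linarith
    fix n
    interpret real_distribution "\<mu> n" by (rule dist)
    have "1 - \<epsilon> < 1 - (exp (- R) * B + exp (- R) * B)" using R2 by (simp add: mult_ac)
    also have "\<dots> \<le> 1 - (exp (- R) * (\<integral>y. exp (a * y) \<partial>\<mu> n) + exp (- R) * (\<integral>y. exp (- b * y) \<partial>\<mu> n))"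
      using le[of n] by (intro diff_left_mono add_mono mult_left_mono) auto
    also have "\<dots> = (\<integral>y. 1 - (exp (- R) * exp (a * y) + exp (- R) * exp (- b * y)) \<partial>\<mu> n)"
      using int[of n] prob_space by simp
    also have "\<dots> \<le> (\<integral>y. indicator {- R / b<..R / a} y \<partial>\<mu> n)"
    proof (rule integral_mono)
      fix y :: real
      have "1 \<le> exp (- R) * exp (a * y)" if "y > R / a"
        using that assms by (simp flip: exp_add add: field_simps)
      moreover have "1 \<le> exp (- R) * exp (- b * y)" if "y \<le> - R / b"
        using that assms by (simp flip: exp_add add: field_simps)
      moreover have "0 < exp (- R) * exp (- b * y)" "0 < exp (- R) * exp (a * y)" by simp_all
      ultimately show "1 - (exp (- R) * exp (a * y) + exp (- R) * exp (- b * y)) \<le> indicator {- R / b<..R / a} y"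
        unfolding indicator_def of_bool_def by (smt (verit) greaterThanAtMost_iff)
    qed (use int[of n] in \<open>auto simp: emeasure_eq_measure\<close>)
    also have "\<dots> = measure (\<mu> n) {- R / b<..R / a}" by simp
    finally show "1 - \<epsilon> < measure (\<mu> n) {- R / b<..R / a}" .
  qed
qed (rule dist)

text \<open>Weak convergence tests only bounded continuous functions, so X = exp(l y) is cut off at
  height k + 1. The inequality X - X^2 / (k + 1) <= min X (k + 1) bounds the loss by the transform
  at 2 l, uniformly along the sequence; this is the purpose of the assumptions at 2 l.\<close>

lemma exp_moments_weak_limit:
  fixes \<mu> :: "nat \<Rightarrow> real measure" and l :: real
  assumes dist: "\<And>n. real_distribution (\<mu> n)" and \<nu>: "real_distribution \<nu>"
    and conv: "weak_conv_m \<mu> \<nu>"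
    and int: "\<And>n. integrable (\<mu> n) (\<lambda>y. exp (l * y))" "\<And>n. integrable (\<mu> n) (\<lambda>y. exp (2 * l * y))"
    and lim: "(\<lambda>n. \<integral>y. exp (l * y) \<partial>\<mu> n) \<longlonglongrightarrow> G" "(\<lambda>n. \<integral>y. exp (2 * l * y) \<partial>\<mu> n) \<longlonglongrightarrow> G2"
  shows "integrable \<nu> (\<lambda>y. exp (l * y))" "(\<integral>y. exp (l * y) \<partial>\<nu>) = G"
proof -
  define f where "f = (\<lambda>k y. min (exp (l * y)) (real (Suc k)))"
  have f [measurable]: "f k \<in> borel_measurable borel" for k by (simp add: f_def)
  have fb: "norm (f k y) \<le> real (Suc k)" for k y by (auto simp: f_def)
  have intf: "integrable M (f k)" if "real_distribution M" for M k
  proof -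
    interpret real_distribution M by fact
    show ?thesis using fb by (intro integrable_const_bound[where B = "real (Suc k)"] always_eventually allI) auto
  qed
  have limf: "(\<lambda>n. \<integral>y. f k y \<partial>\<mu> n) \<longlonglongrightarrow> (\<integral>y. f k y \<partial>\<nu>)" for k
    using dist \<nu> conv
  proof (rule weak_conv_imp_integral_bdd_continuous_conv)
    show "isCont (f k) y" for y unfolding f_def by (intro continuous_intros)
  qed (rule fb)
  have upper: "(\<integral>y. f k y \<partial>\<nu>) \<le> G" for k
    by (rule LIMSEQ_le[OF limf lim(1)], rule exI[of _ 0], intro allI impI integral_mono intf int dist) (simp add: f_def)
  have lower: "G - G2 / real (Suc k) \<le> (\<integral>y. f k y \<partial>\<nu>)" for k
  proof (rule LIMSEQ_le[OF _ limf])
    show "(\<lambda>n. (\<integral>y. exp (l * y) \<partial>\<mu> n) - (\<integral>y. exp (2 * l * y) \<partial>\<mu> n) / real (Suc k)) \<longlonglongrightarrow> G - G2 / real (Suc k)"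
      by (intro tendsto_intros lim) auto
    have "(\<integral>y. exp (l * y) \<partial>\<mu> n) - (\<integral>y. exp (2 * l * y) \<partial>\<mu> n) / real (Suc k) \<le> (\<integral>y. f k y \<partial>\<mu> n)" for n
    proof -
      have "(\<integral>y. exp (l * y) \<partial>\<mu> n) - (\<integral>y. exp (2 * l * y) \<partial>\<mu> n) / real (Suc k)
          = (\<integral>y. exp (l * y) - exp (2 * l * y) / real (Suc k) \<partial>\<mu> n)"
        using int[of n] by simp
      also have "\<dots> \<le> (\<integral>y. f k y \<partial>\<mu> n)"
      proof (intro integral_mono Bochner_Integration.integrable_diff integrable_divide int intf dist)
        fix y :: real
        have "exp (2 * l * y) = exp (l * y) * exp (l * y)" by (simp flip: exp_add)
        hence e: "exp (2 * l * y) / real (Suc k) = exp (l * y) * exp (l * y) / real (Suc k)" by (simp only:)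
        have "exp (l * y) - exp (l * y) * exp (l * y) / real (Suc k) \<le> 0" if "exp (l * y) > real (Suc k)"
          using that by (simp add: pos_le_divide_eq)
        moreover have "exp (l * y) * exp (l * y) / real (Suc k) \<ge> 0" by simp
        ultimately show "exp (l * y) - exp (2 * l * y) / real (Suc k) \<le> f k y"
          unfolding e f_def min_def by (smt (verit) of_nat_0_le_iff)
      qed
      finally show ?thesis .
    qed
    thus "\<exists>N. \<forall>n\<ge>N. (\<integral>y. exp (l * y) \<partial>\<mu> n) - (\<integral>y. exp (2 * l * y) \<partial>\<mu> n) / real (Suc k) \<le> (\<integral>y. f k y \<partial>\<mu> n)"
      by blast
  qed
  have ilim: "(\<lambda>k. \<integral>y. f k y \<partial>\<nu>) \<longlonglongrightarrow> G"
  proof (rule tendsto_sandwich[of "\<lambda>k. G - G2 / real (Suc k)" _ _ "\<lambda>_. G"])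
    have "(\<lambda>k. G - G2 * (1 / real (Suc k))) \<longlonglongrightarrow> G - G2 * 0"
      by (intro tendsto_intros LIMSEQ_Suc lim_1_over_n)
    thus "(\<lambda>k. G - G2 / real (Suc k)) \<longlonglongrightarrow> G" by simp
  qed (use upper lower in auto)
  have "mono (\<lambda>k. f k y)" for y by (auto simp: f_def mono_def)
  hence mono: "AE y in \<nu>. mono (\<lambda>k. f k y)" by simp
  have "(\<lambda>k. f k y) \<longlonglongrightarrow> exp (l * y)" for y
  proof (rule tendsto_eventually)
    have "eventually (\<lambda>k. exp (l * y) \<le> real k) sequentially"
      by (intro eventually_sequentiallyI[of "nat \<lceil>exp (l * y)\<rceil>"]) linarith
    thus "eventually (\<lambda>k. f k y = exp (l * y)) sequentially"
      by eventually_elim (auto simp: f_def min_def)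
  qed
  hence lim': "AE y in \<nu>. (\<lambda>k. f k y) \<longlonglongrightarrow> exp (l * y)" by simp
  interpret \<nu>: real_distribution \<nu> by fact
  show "integrable \<nu> (\<lambda>y. exp (l * y))" "(\<integral>y. exp (l * y) \<partial>\<nu>) = G"
    by (rule integrable_monotone_convergence integral_monotone_convergence;
        use intf[OF \<nu>] mono lim' ilim in simp)+
qed

text \<open>Tightness yields a weak limit along a subsequence, and Euler's formula identifies its
  transform. The passage to the limit at l uses the transforms at 2 l, available for 2 l > -1; hence
  the threshold -1/2.\<close>

lemma Gamma_powr_distribution:
  fixes d :: real
  assumes "d > 0"
  obtains \<nu> where "real_distribution \<nu>"
    "\<And>l. l > -1/2 \<Longrightarrow> integrable \<nu> (\<lambda>y. exp (l * y))"
    "\<And>l. l > -1/2 \<Longrightarrow> (\<integral>y. exp (l * y) \<partial>\<nu>) = Gamma (1 + l) powr d"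
proof -
  have "\<exists>M. real_distribution M \<and> (\<forall>l>-1. (\<integral>\<^sup>+y. ennreal (exp (l * y)) \<partial>M) = ennreal (Gamma_series' (1 + l) (Suc m) powr d))" for m
    using Gamma_product_distribution[OF assms, of "Suc m"] by blast
  then obtain \<mu> where dist: "\<And>m. real_distribution (\<mu> m)"
    and \<mu>: "\<And>m l. l > -1 \<Longrightarrow> (\<integral>\<^sup>+y. ennreal (exp (l * y)) \<partial>\<mu> m) = ennreal (Gamma_series' (1 + l) (Suc m) powr d)"
    by metis
  have hbi: "has_bochner_integral (\<mu> m) (\<lambda>y. exp (l * y)) (Gamma_series' (1 + l) (Suc m) powr d)" if "l > -1" for l m
  proof (rule has_bochner_integral_nn_integral)
    interpret real_distribution "\<mu> m" by (rule dist)
    show "(\<lambda>y. exp (l * y)) \<in> borel_measurable (\<mu> m)" by measurable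
  qed (use \<mu>[OF that] in auto)
  have int: "integrable (\<mu> m) (\<lambda>y. exp (l * y))"
    and val: "(\<integral>y. exp (l * y) \<partial>\<mu> m) = Gamma_series' (1 + l) (Suc m) powr d" if "l > -1" for l m
    using hbi[OF that] by (auto simp: has_bochner_integral_iff)
  have lim: "(\<lambda>m. \<integral>y. exp (l * y) \<partial>\<mu> m) \<longlonglongrightarrow> Gamma (1 + l) powr d" if "l > -1" for l
  proof -
    have "Gamma (1 + l) > 0" using that by (intro Gamma_real_pos) auto
    hence "(\<lambda>m. Gamma_series' (1 + l) (Suc m) powr d) \<longlonglongrightarrow> Gamma (1 + l) powr d"
      by (intro tendsto_intros LIMSEQ_Suc[OF Gamma_series'_LIMSEQ]) auto
    thus ?thesis using that by (simp add: val)
  qed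
  have "tight \<mu>"
  proof -
    obtain B1 where B1: "\<And>n. norm (\<integral>y. exp (1 * y) \<partial>\<mu> n) \<le> B1"
      using convergent_imp_Bseq[OF convergentI[OF lim[of 1]]] by (auto simp: Bseq_def)
    obtain B2 where B2: "\<And>n. norm (\<integral>y. exp (- (1/2) * y) \<partial>\<mu> n) \<le> B2"
      using convergent_imp_Bseq[OF convergentI[OF lim[of "- (1/2)"]]] by (auto simp: Bseq_def)
    show ?thesis
    proof (rule tight_if_exp_moments_bounded[where a = 1 and b = "1/2" and B = "max B1 B2", OF dist])
      show "(\<integral>y. exp (1 * y) \<partial>\<mu> n) \<le> max B1 B2" for n using B1[of n] by auto
      show "(\<integral>y. exp (- (1/2) * y) \<partial>\<mu> n) \<le> max B1 B2" for n
        using B2[of n] by (simp add: le_max_iff_disj)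
    qed (use int[of 1] int[of "-(1/2)"] in auto)
  qed
  then obtain r \<nu> where r: "strict_mono r" and \<nu>: "real_distribution \<nu>" and conv: "weak_conv_m (\<mu> \<circ> id \<circ> r) \<nu>"
    using tight_imp_convergent_subsubsequence[of \<mu> id] by (auto simp: strict_mono_def)
  have "integrable \<nu> (\<lambda>y. exp (l * y)) \<and> (\<integral>y. exp (l * y) \<partial>\<nu>) = Gamma (1 + l) powr d" if "l > -1/2" for l
  proof -
    have l: "l > -1" "2 * l > -1" using that by auto
    show ?thesis
      using exp_moments_weak_limit[of "\<lambda>n. \<mu> (r n)" \<nu> l "Gamma (1 + l) powr d" "Gamma (1 + 2 * l) powr d"]
        dist \<nu> conv int[OF l(1)] int[OF l(2)]
        LIMSEQ_subseq_LIMSEQ[OF lim[OF l(1)] r] LIMSEQ_subseq_LIMSEQ[OF lim[OF l(2)] r]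
      by (simp add: o_def)
  qed
  with \<nu> show ?thesis using that by blast
qed

section \<open>Fourier inversion\<close>

lemma fourier_transform_gaussian:
  assumes "\<epsilon> > 0"
  shows "(\<integral>x. exp (- (\<epsilon> * x)\<^sup>2 / 2) *\<^sub>R iexp (x * v) \<partial>lborel)
           = complex_of_real (sqrt (2 * pi) / \<epsilon> * exp (- (v / \<epsilon>)\<^sup>2 / 2))"
proof -
  have "complex_of_real (exp (- (v / \<epsilon>)\<^sup>2 / 2)) = (\<integral>x. iexp (v / \<epsilon> * x) \<partial>std_normal_distribution)"
    using fun_cong[OF char_std_normal_distribution, of "v / \<epsilon>"] by (simp add: char_def)
  also have "\<dots> = (\<integral>x. std_normal_density x *\<^sub>R iexp (v / \<epsilon> * x) \<partial>lborel)"
    by (subst integral_density) auto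
  also have "\<dots> = \<bar>\<epsilon>\<bar> *\<^sub>R (\<integral>x. std_normal_density (0 + \<epsilon> * x) *\<^sub>R iexp (v / \<epsilon> * (0 + \<epsilon> * x)) \<partial>lborel)"
    using assms by (intro lborel_integral_real_affine) auto
  also have "(\<lambda>x. std_normal_density (0 + \<epsilon> * x) *\<^sub>R iexp (v / \<epsilon> * (0 + \<epsilon> * x)))
      = (\<lambda>x. (1 / sqrt (2 * pi)) *\<^sub>R (exp (- (\<epsilon> * x)\<^sup>2 / 2) *\<^sub>R iexp (x * v)))"
    using assms by (auto simp: std_normal_density_def mult_ac)
  finally show ?thesis
    using assms by (simp add: scaleR_conv_of_real field_simps)
qed

lemma integrable_gaussian:
  assumes "\<epsilon> > (0::real)"
  shows "integrable lborel (\<lambda>x. exp (- (\<epsilon> * x)\<^sup>2 / 2))"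
proof -
  have "integrable lborel (\<lambda>x. std_normal_density (0 + \<epsilon> * x))"
    using assms by (intro lborel_integrable_real_affine) auto
  hence "integrable lborel (\<lambda>x. sqrt (2 * pi) * std_normal_density (0 + \<epsilon> * x))"
    by (rule integrable_mult_right)
  thus ?thesis by (simp add: std_normal_density_def)
qed

text \<open>A Gaussian weight makes the double integral absolutely convergent, so Fubini applies and
  the inner integral becomes a Gaussian kernel centred at y. Removing the weight is dominated
  convergence on both sides: by the integrability of \<phi> on one, by the boundedness and
  continuity of g on the other.\<close>

lemma fourier_inversion:
  fixes g :: "real \<Rightarrow> real" and \<phi> :: "real \<Rightarrow> complex"
  assumes g: "integrable lborel g" "\<And>u. \<bar>g u\<bar> \<le> B" "\<And>u. isCont g u"
    and \<phi>: "\<And>x. \<phi> x = (\<integral>u. g u *\<^sub>R iexp (- (x * u)) \<partial>lborel)"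
    and int: "integrable lborel \<phi>"
  shows "(\<integral>x. iexp (x * y) * \<phi> x \<partial>lborel) = complex_of_real (2 * pi * g y)"
proof -
  have [measurable]: "g \<in> borel_measurable borel" "\<phi> \<in> borel_measurable borel"
    using g(1) int by auto
  define w where "w = (\<lambda>\<epsilon> x :: real. exp (- (\<epsilon> * x)\<^sup>2 / 2))"
  have [measurable]: "w \<epsilon> \<in> borel_measurable borel" for \<epsilon> by (simp add: w_def)
  have w_le: "0 \<le> w \<epsilon> x" "w \<epsilon> x \<le> 1" for \<epsilon> x by (auto simp: w_def)
  have smoothed: "(\<integral>x. w \<epsilon> x *\<^sub>R (iexp (x * y) * \<phi> x) \<partial>lborel)
      = complex_of_real (2 * pi * (\<integral>s. std_normal_density s * g (y + \<epsilon> * s) \<partial>lborel))" if "\<epsilon> > 0" for \<epsilon>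
  proof -
    let ?F = "\<lambda>x u. (w \<epsilon> x * g u) *\<^sub>R iexp (x * (y - u))"
    have wint: "integrable lborel (w \<epsilon>)" unfolding w_def by (rule integrable_gaussian[OF that])
    have "(\<integral>x. w \<epsilon> x *\<^sub>R (iexp (x * y) * \<phi> x) \<partial>lborel) = (\<integral>x. (\<integral>u. ?F x u \<partial>lborel) \<partial>lborel)"
    proof (intro Bochner_Integration.integral_cong refl)
      fix x :: real
      have "w \<epsilon> x *\<^sub>R (iexp (x * y) * \<phi> x) = (w \<epsilon> x *\<^sub>R iexp (x * y)) * (\<integral>u. g u *\<^sub>R iexp (- (x * u)) \<partial>lborel)"
        by (simp add: \<phi>)
      also have "\<dots> = (\<integral>u. (w \<epsilon> x *\<^sub>R iexp (x * y)) * (g u *\<^sub>R iexp (- (x * u))) \<partial>lborel)"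
        by (rule integral_mult_right_zero [symmetric])
      also have "\<dots> = (\<integral>u. ?F x u \<partial>lborel)"
        by (intro Bochner_Integration.integral_cong refl)
           (simp add: scaleR_conv_of_real ring_distribs exp_diff exp_minus field_simps)
      finally show "w \<epsilon> x *\<^sub>R (iexp (x * y) * \<phi> x) = (\<integral>u. ?F x u \<partial>lborel)" .
    qed
    also have "\<dots> = (\<integral>u. (\<integral>x. ?F x u \<partial>lborel) \<partial>lborel)"
    proof (rule lborel_pair.Fubini_integral [symmetric], rule lborel_pair.Fubini_integrable)
      show "(\<lambda>(x, u). ?F x u) \<in> borel_measurable (lborel \<Otimes>\<^sub>M lborel)" by measurable
      have "(\<lambda>x. \<integral>u. norm (case (x, u) of (x, u) \<Rightarrow> ?F x u) \<partial>lborel) = (\<lambda>x. w \<epsilon> x * (\<integral>u. \<bar>g u\<bar> \<partial>lborel))"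
        using w_le by (auto simp: abs_mult)
      moreover have "integrable lborel (\<lambda>x. w \<epsilon> x * (\<integral>u. \<bar>g u\<bar> \<partial>lborel))"
        using wint by simp
      ultimately show "integrable lborel (\<lambda>x. \<integral>u. norm (case (x, u) of (x, u) \<Rightarrow> ?F x u) \<partial>lborel)"
        by (simp only:)
      have "integrable lborel (\<lambda>u. ?F x u)" for x
        by (rule Bochner_Integration.integrable_bound[of _ "\<lambda>u. w \<epsilon> x * g u"]) (use g(1) in auto)
      thus "AE x in lborel. integrable lborel (\<lambda>u. case (x, u) of (x, u) \<Rightarrow> ?F x u)" by simp
    qed
    also have "\<dots> = (\<integral>u. complex_of_real (g u * (sqrt (2 * pi) / \<epsilon> * exp (- ((y - u) / \<epsilon>)\<^sup>2 / 2))) \<partial>lborel)"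
    proof (intro Bochner_Integration.integral_cong refl)
      fix u
      have "(\<integral>x. ?F x u \<partial>lborel) = (\<integral>x. g u *\<^sub>R (w \<epsilon> x *\<^sub>R iexp (x * (y - u))) \<partial>lborel)"
        by (simp add: mult.commute)
      also have "\<dots> = g u *\<^sub>R (\<integral>x. w \<epsilon> x *\<^sub>R iexp (x * (y - u)) \<partial>lborel)" 
        by (rule integral_scaleR_right) 
      also have "(\<integral>x. w \<epsilon> x *\<^sub>R iexp (x * (y - u)) \<partial>lborel) = complex_of_real (sqrt (2 * pi) / \<epsilon> * exp (- ((y - u) / \<epsilon>)\<^sup>2 / 2))"
        unfolding w_def by (rule fourier_transform_gaussian[OF that])
      finally show "(\<integral>x. ?F x u \<partial>lborel) = complex_of_real (g u * (sqrt (2 * pi) / \<epsilon> * exp (- ((y - u) / \<epsilon>)\<^sup>2 / 2)))"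
        by (simp add: scaleR_conv_of_real)
    qed
    also have "\<dots> = complex_of_real (\<integral>u. g u * (sqrt (2 * pi) / \<epsilon> * exp (- ((y - u) / \<epsilon>)\<^sup>2 / 2)) \<partial>lborel)"
      by (rule integral_complex_of_real)
    \<comment> \<open>Substituting u = y + \<epsilon> s turns the kernel into an average of g around
      y under the standard normal law, at scale \<epsilon>.\<close>
    also have "(\<integral>u. g u * (sqrt (2 * pi) / \<epsilon> * exp (- ((y - u) / \<epsilon>)\<^sup>2 / 2)) \<partial>lborel)
       = \<bar>\<epsilon>\<bar> *\<^sub>R (\<integral>s. g (y + \<epsilon> * s) * (sqrt (2 * pi) / \<epsilon> * exp (- ((y - (y + \<epsilon> * s)) / \<epsilon>)\<^sup>2 / 2)) \<partial>lborel)"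
      using that by (intro lborel_integral_real_affine) auto
    also have "\<dots> = (\<integral>s. \<epsilon> * (g (y + \<epsilon> * s) * (sqrt (2 * pi) / \<epsilon> * exp (- ((y - (y + \<epsilon> * s)) / \<epsilon>)\<^sup>2 / 2))) \<partial>lborel)"
      using that by simp
    also have "\<dots> = (\<integral>s. 2 * pi * (std_normal_density s * g (y + \<epsilon> * s)) \<partial>lborel)"
    proof (intro Bochner_Integration.integral_cong refl)
      fix s
      have "(y - (y + \<epsilon> * s)) / \<epsilon> = - s" using that by simp
      hence *: "((y - (y + \<epsilon> * s)) / \<epsilon>)\<^sup>2 = s\<^sup>2" by simp
      have "2 * pi * (std_normal_density s * g (y + \<epsilon> * s))
          = (2 * pi * (1 / sqrt (2 * pi))) * exp (- s\<^sup>2 / 2) * g (y + \<epsilon> * s)"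
        unfolding std_normal_density_def by (simp only: mult.assoc)
      also have "2 * pi * (1 / sqrt (2 * pi)) = sqrt (2 * pi)"
        by (simp add: real_div_sqrt)
      finally show "\<epsilon> * (g (y + \<epsilon> * s) * (sqrt (2 * pi) / \<epsilon> * exp (- ((y - (y + \<epsilon> * s)) / \<epsilon>)\<^sup>2 / 2)))
          = 2 * pi * (std_normal_density s * g (y + \<epsilon> * s))"
        unfolding * using that by auto
    qed
    finally show ?thesis by simp
  qed
  define \<epsilon> where "\<epsilon> = (\<lambda>k. 1 / real (Suc k))"
  have \<epsilon>: "\<epsilon> k > 0" for k by (simp add: \<epsilon>_def)
  have \<epsilon>_lim: "\<epsilon> \<longlonglongrightarrow> 0" unfolding \<epsilon>_def by (rule LIMSEQ_Suc[OF lim_1_over_n])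
  have "(\<lambda>k. \<integral>x. w (\<epsilon> k) x *\<^sub>R (iexp (x * y) * \<phi> x) \<partial>lborel) \<longlonglongrightarrow> (\<integral>x. iexp (x * y) * \<phi> x \<partial>lborel)"
  proof (rule integral_dominated_convergence[where w = "\<lambda>x. norm (\<phi> x)"])
    show "AE x in lborel. (\<lambda>k. w (\<epsilon> k) x *\<^sub>R (iexp (x * y) * \<phi> x)) \<longlonglongrightarrow> iexp (x * y) * \<phi> x"
    proof (intro always_eventually allI)
      fix x
      have "(\<lambda>k. w (\<epsilon> k) x *\<^sub>R (iexp (x * y) * \<phi> x)) \<longlonglongrightarrow> exp (- (0 * x)\<^sup>2 / 2) *\<^sub>R (iexp (x * y) * \<phi> x)"
        unfolding w_def by (intro tendsto_intros \<epsilon>_lim) auto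
      thus "(\<lambda>k. w (\<epsilon> k) x *\<^sub>R (iexp (x * y) * \<phi> x)) \<longlonglongrightarrow> iexp (x * y) * \<phi> x" by simp
    qed
    show "AE x in lborel. norm (w (\<epsilon> k) x *\<^sub>R (iexp (x * y) * \<phi> x)) \<le> norm (\<phi> x)" for k
      using w_le by (auto simp: norm_mult mult_left_le_one_le)
  qed (use int in auto)
  hence 1: "(\<lambda>k. complex_of_real (2 * pi * (\<integral>s. std_normal_density s * g (y + \<epsilon> k * s) \<partial>lborel)))
      \<longlonglongrightarrow> (\<integral>x. iexp (x * y) * \<phi> x \<partial>lborel)"
    by (simp only: smoothed[OF \<epsilon>])
  have 2: "(\<lambda>k. complex_of_real (2 * pi * (\<integral>s. std_normal_density s * g (y + \<epsilon> k * s) \<partial>lborel)))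
      \<longlonglongrightarrow> complex_of_real (2 * pi * (\<integral>s. std_normal_density s * g y \<partial>lborel))"
  proof (intro tendsto_intros, rule integral_dominated_convergence[where w = "\<lambda>s. B * std_normal_density s"])
    show "AE s in lborel. (\<lambda>k. std_normal_density s * g (y + \<epsilon> k * s)) \<longlonglongrightarrow> std_normal_density s * g y"
    proof (intro always_eventually allI tendsto_intros)
      fix s
      have "(\<lambda>k. y + \<epsilon> k * s) \<longlonglongrightarrow> y + 0 * s" by (intro tendsto_intros \<epsilon>_lim)
      thus "(\<lambda>k. g (y + \<epsilon> k * s)) \<longlonglongrightarrow> g y" by (intro isCont_tendsto_compose[OF g(3)]) simp
    qed
    show "AE s in lborel. norm (std_normal_density s * g (y + \<epsilon> k * s)) \<le> B * std_normal_density s" for k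
    proof (intro always_eventually allI)
      fix s
      show "norm (std_normal_density s * g (y + \<epsilon> k * s)) \<le> B * std_normal_density s"
        using mult_right_mono[OF g(2)[of "y + \<epsilon> k * s"], of "std_normal_density s"]
        by (simp add: abs_mult mult.commute)
    qed
  qed auto
  have "(\<integral>s. std_normal_density s * g y \<partial>lborel) = g y" by simp
  with LIMSEQ_unique[OF 1 2] show ?thesis by (simp only:)
qed

section \<open>The exponential law in logarithmic coordinates\<close>

lemma has_bochner_integral_powr_exp:
  fixes s a :: real
  assumes "s > 0" "a > 0"
  shows "has_bochner_integral lborel (\<lambda>t. indicator {0..} t * t powr (s - 1) * exp (- (a * t))) (Gamma s * a powr (- s))"
  by (rule has_bochner_integral_nn_integral)
     (use nn_integral_powr_exp[OF assms] assms in \<open>auto simp: Gamma_real_pos less_imp_le\<close>)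

text \<open>The density of ln T for a standard exponential variable T, a reflected Gumbel law. In
  this coordinate the Mellin integral for Gamma becomes a Laplace transform, and on the imaginary
  axis a Fourier transform.\<close>

definition log_exp_density :: "real \<Rightarrow> real" where
  "log_exp_density u = exp (u - exp u)"

lemma log_exp_density_measurable [measurable]: "log_exp_density \<in> borel_measurable borel"
  by (simp add: log_exp_density_def [abs_def])

lemma log_exp_density_pos: "log_exp_density u > 0"
  by (simp add: log_exp_density_def)

lemma has_bochner_integral_log_exp_density:
  assumes "l > -1"
  shows "has_bochner_integral lborel (\<lambda>u. log_exp_density u * exp (l * u)) (Gamma (1 + l))"
proof -
  define f where "f = (\<lambda>u. log_exp_density u * exp (l * u))"
  define h where "h = (\<lambda>t. indicator {0..} t * t powr ((1 + l) - 1) * exp (- (1 * t)))"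
  have h: "has_bochner_integral lborel h (Gamma (1 + l))"
    using has_bochner_integral_powr_exp[of "1 + l" 1] assms by (simp add: h_def)
  have eq: "f (ln t) * (1 / t) = h t" if "t > 0" for t
    using that by (simp add: f_def h_def log_exp_density_def exp_diff powr_def exp_minus field_simps)
  have ein: "einterval 0 \<infinity> = {0::real<..}" by (auto simp: einterval_iff)
  have "set_integrable lborel {0<..} h"
    unfolding set_integrable_def using h by (intro integrable_mult_indicator) (auto simp: has_bochner_integral_iff)
  hence int: "set_integrable lborel (einterval 0 \<infinity>) (\<lambda>t. f (ln t) * (1 / t))"
    unfolding ein by (subst set_integrable_cong[OF refl refl eq]) auto
  have *: "set_integrable lborel (einterval (-\<infinity>) \<infinity>) f"
    "(LBINT u=-\<infinity>..\<infinity>. f u) = (LBINT t=0..\<infinity>. f (ln t) * (1 / t))"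
  proof -
    have A: "((ereal \<circ> ln \<circ> real_of_ereal) \<longlongrightarrow> - \<infinity>) (at_right 0)"
      unfolding zero_ereal_def by (simp add: ereal_tendsto_simps ln_at_0)
    have B: "((ereal \<circ> ln \<circ> real_of_ereal) \<longlongrightarrow> \<infinity>) (at_left \<infinity>)"
      by (simp add: ereal_tendsto_simps ln_at_top)
    note sub = interval_integral_substitution_nonneg[OF _ _ _ _ _ _ A B int]
    show "set_integrable lborel (einterval (-\<infinity>) \<infinity>) f"
      "(LBINT u=-\<infinity>..\<infinity>. f u) = (LBINT t=0..\<infinity>. f (ln t) * (1 / t))"
      by (rule sub; auto intro!: derivative_eq_intros continuous_intros simp: f_def log_exp_density_def)+
  qed
  have "(LBINT u=-\<infinity>..\<infinity>. f u) = (\<integral>u. f u \<partial>lborel)"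
    by (simp add: interval_integral_to_infinity_eq interval_lebesgue_integral_def set_lebesgue_integral_def)
  moreover have "(LBINT t=0..\<infinity>. f (ln t) * (1 / t)) = (\<integral>t. h t \<partial>lborel)"
    unfolding interval_lebesgue_integral_def ein set_lebesgue_integral_def
  proof (simp, rule integral_cong_AE)
    show "AE t in lborel. indicat_real {0<..} t * f (ln t) / t = h t"
      using AE_lborel_singleton[of "0::real"]
    proof eventually_elim
      fix t :: real assume "t \<noteq> 0"
      thus "indicat_real {0<..} t * f (ln t) / t = h t"
        using eq[of t] by (cases "t > 0") (auto simp: h_def)
    qed
  qed (simp_all add: f_def h_def)
  ultimately show ?thesis
    using * h by (simp add: has_bochner_integral_iff f_def set_integrable_def)
qed

lemma fourier_log_exp_density:
  assumes "Re z > -1"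
  shows "(\<integral>u. log_exp_density u *\<^sub>R exp (z * complex_of_real u) \<partial>lborel) = Gamma (1 + z)"
proof -
  define M where "M = density lborel (\<lambda>u. ennreal (log_exp_density u))"
  have int: "integrable M (\<lambda>u. exp (l * u))" and val: "(\<integral>u. exp (l * u) \<partial>M) = Gamma (1 + l)" if "l > -1" for l
  proof -
    have "integrable M (\<lambda>u. exp (l * u)) \<longleftrightarrow> integrable lborel (\<lambda>u. log_exp_density u *\<^sub>R exp (l * u))"
      unfolding M_def by (rule integrable_density) (auto simp: log_exp_density_pos less_imp_le)
    thus "integrable M (\<lambda>u. exp (l * u))"
      using has_bochner_integral_log_exp_density[OF that] by (simp add: has_bochner_integral_iff)
    have "(\<integral>u. exp (l * u) \<partial>M) = (\<integral>u. log_exp_density u *\<^sub>R exp (l * u) \<partial>lborel)"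
      unfolding M_def by (rule integral_density) (auto simp: log_exp_density_pos less_imp_le)
    thus "(\<integral>u. exp (l * u) \<partial>M) = Gamma (1 + l)"
      using has_bochner_integral_log_exp_density[OF that] by (simp add: has_bochner_integral_iff)
  qed
  have "(\<integral>u. exp (z * complex_of_real u) \<partial>M) = Gamma (1 + z)"
  \<comment> \<open>The left edge is the first pole of Gamma(1 + z); the right edge only has to lie
    beyond z.\<close>
  proof (rule laplace_transform_eqI[where a = "-1" and b = "Re z + 1"])
    show "(\<lambda>z. Gamma (1 + z) :: complex) holomorphic_on {w. -1 < Re w \<and> Re w < Re z + 1}"
    proof (intro holomorphic_intros)
      fix w assume "w \<in> {w. -1 < Re w \<and> Re w < Re z + 1}"
      hence "Re (1 + w) > 0" by simp
      thus "1 + w \<notin> \<int>\<^sub>\<le>\<^sub>0" by (auto elim!: nonpos_Ints_cases simp del: plus_complex.sel)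
    qed
    show "complex_of_real (\<integral>u. exp (l * u) \<partial>M) = Gamma (1 + complex_of_real l)" if "-1 < l" for l
      using val[OF that] Gamma_complex_of_real[of "1 + l"] by simp
  qed (use assms int in \<open>auto simp: M_def\<close>)
  moreover have "(\<integral>u. exp (z * complex_of_real u) \<partial>M) = (\<integral>u. log_exp_density u *\<^sub>R exp (z * complex_of_real u) \<partial>lborel)"
    unfolding M_def by (rule integral_density) (auto simp: log_exp_density_pos less_imp_le)
  ultimately show ?thesis by simp
qed

text \<open>On the line with real part 3 the integral gives |Gamma| <= Gamma(3) = 2. Two
  applications of the functional equation divide by |z| |z + 1| >= |z|^2 = 1 + x^2, and this
  quadratic decay suffices for integrability.\<close>

lemma norm_Gamma_vertical_le: "norm (Gamma (1 - \<i> * complex_of_real x)) \<le> 2 / (1 + x\<^sup>2)"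
proof -
  let ?z = "1 - \<i> * complex_of_real x"
  have nz: "?z \<notin> \<int>\<^sub>\<le>\<^sub>0" "?z + 1 \<notin> \<int>\<^sub>\<le>\<^sub>0"
    by (auto elim!: nonpos_Ints_cases simp: complex_eq_iff)
  have "norm (Gamma (3 - \<i> * complex_of_real x)) = norm (\<integral>u. log_exp_density u *\<^sub>R exp ((2 - \<i> * complex_of_real x) * complex_of_real u) \<partial>lborel)"
    by (subst fourier_log_exp_density) (auto simp: algebra_simps)
  also have "\<dots> \<le> (\<integral>u. log_exp_density u * exp (2 * u) \<partial>lborel)"
    by (rule order_trans[OF integral_norm_bound]) (simp add: log_exp_density_pos less_imp_le)
  also have "\<dots> = Gamma (1 + 2)"
    using has_bochner_integral_log_exp_density[of 2] by (simp add: has_bochner_integral_iff)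
  also have "\<dots> = 2"
    using Gamma_fact[of 2, where 'a = real] by (simp add: fact_numeral)
  finally have 1: "norm (Gamma (3 - \<i> * complex_of_real x)) \<le> 2" .
  have "Gamma (3 - \<i> * complex_of_real x) = (?z + 1) * Gamma (?z + 1)"
    using Gamma_plus1[OF nz(2)] by (simp add: algebra_simps)
  also have "Gamma (?z + 1) = ?z * Gamma ?z"
    using Gamma_plus1[OF nz(1)] by simp
  finally have "norm (Gamma (3 - \<i> * complex_of_real x)) = norm (?z + 1) * norm ?z * norm (Gamma ?z)"
    by (simp add: norm_mult)
  moreover have "norm ?z \<le> norm (?z + 1)"
    by (simp add: cmod_def)
  hence "norm ?z * norm ?z * norm (Gamma ?z) \<le> norm (?z + 1) * norm ?z * norm (Gamma ?z)"
    by (intro mult_right_mono) auto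
  moreover have "norm ?z * norm ?z = 1 + x\<^sup>2"
    by (simp add: cmod_def)
  ultimately have "(1 + x\<^sup>2) * norm (Gamma ?z) \<le> 2"
    using 1 by simp
  moreover have "1 + x\<^sup>2 > 0" by (simp add: add_pos_nonneg)
  ultimately show ?thesis by (simp add: field_simps)
qed

lemma integrable_Gamma_vertical: "integrable lborel (\<lambda>x. Gamma (1 - \<i> * complex_of_real x))"
proof (rule Bochner_Integration.integrable_bound)
  have "integrable lborel (\<lambda>x::real. inverse (1 + x\<^sup>2))"
    using integrable_inverse_1_plus_square by (simp add: set_integrable_def)
  thus "integrable lborel (\<lambda>x::real. 2 * inverse (1 + x\<^sup>2))" by simp
  have "isCont (\<lambda>x. Gamma (1 - \<i> * complex_of_real x)) x" for x
    by (intro continuous_intros) (auto elim!: nonpos_Ints_cases simp: complex_eq_iff)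
  hence "continuous_on UNIV (\<lambda>x. Gamma (1 - \<i> * complex_of_real x))"
    by (intro continuous_at_imp_continuous_on) auto
  thus "(\<lambda>x. Gamma (1 - \<i> * complex_of_real x)) \<in> borel_measurable lborel"
    by (simp add: borel_measurable_continuous_onI)
  show "AE x in lborel. norm (Gamma (1 - \<i> * complex_of_real x)) \<le> norm (2 * inverse (1 + x\<^sup>2))"
    using norm_Gamma_vertical_le by (auto simp: divide_inverse add_nonneg_nonneg)
qed

lemma Gamma_vertical_fourier_inversion:
  "(\<integral>x. iexp (x * y) * Gamma (1 - \<i> * complex_of_real x) \<partial>lborel) = complex_of_real (2 * pi * log_exp_density y)"
proof (rule fourier_inversion)
  show "integrable lborel log_exp_density"
    using has_bochner_integral_log_exp_density[of 0] by (simp add: has_bochner_integral_iff)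
  show "\<bar>log_exp_density u\<bar> \<le> 1" for u
    using exp_ge_add_one_self[of u] by (simp add: log_exp_density_def del: exp_ge_add_one_self)
  show "isCont log_exp_density u" for u
    unfolding log_exp_density_def [abs_def] by (intro continuous_intros)
  show "Gamma (1 - \<i> * complex_of_real x) = (\<integral>u. log_exp_density u *\<^sub>R iexp (- (x * u)) \<partial>lborel)" for x
    using fourier_log_exp_density[of "- \<i> * complex_of_real x"] by (simp add: mult_ac)
qed (rule integrable_Gamma_vertical)

section \<open>The density as a mixture of exponential densities\<close>

text \<open>The quotient n^n / n! is a single term of the series of exp n, and e <= 3.\<close>

lemma power_div_3_le_fact: "(real n / 3) ^ n \<le> fact n"
proof -
  have "real n ^ n / fact n \<le> exp (real n)"
  proof -
    have "(\<Sum>k\<in>{n}. real n ^ k /\<^sub>R fact k) \<le> (\<Sum>k. real n ^ k /\<^sub>R fact k)"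
      by (intro sum_le_suminf sums_summable[OF exp_converges]) auto
    thus ?thesis by (simp add: exp_def divide_inverse mult.commute)
  qed
  also have "exp (real n) = exp 1 ^ n" by (simp flip: exp_of_nat_mult)
  also have "\<dots> \<le> 3 ^ n" by (intro power_mono exp_le) auto
  finally show ?thesis by (simp add: field_simps)
qed

text \<open>The ratio of consecutive left-hand sides, (2 n + 3)(2 n + 2), is at most 12 (n + 1)^2.
  The estimate compares a moment of order 2 n + 1 with the square of a moment of order n, at a cost
  merely exponential in n.\<close>

lemma fact_double_le: "fact (2 * n + 1) \<le> (12 ^ n * (fact n)\<^sup>2 :: real)"
proof (induction n)
  case (Suc n)
  have "fact (2 * Suc n + 1) = (2 * real n + 3) * (2 * real n + 2) * fact (2 * n + 1)"
    by (simp add: algebra_simps)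
  also have "\<dots> \<le> (12 * (real n + 1)\<^sup>2) * (12 ^ n * (fact n)\<^sup>2)"
  proof (rule mult_mono[OF _ Suc])
    have "0 \<le> real n * real n" by simp
    thus "(2 * real n + 3) * (2 * real n + 2) \<le> 12 * (real n + 1)\<^sup>2"
      unfolding power2_eq_square by (simp add: algebra_simps)
  qed auto
  also have "\<dots> = 12 ^ Suc n * (fact (Suc n))\<^sup>2"
    by (simp add: power_mult_distrib add.commute)
  finally show ?case .
qed simp

text \<open>The parameter c is represented as d + 1. The range l > -1/2 contains 0 in its interior,
  which gives the vertical line of the inversion, and all nonnegative integers, which give the
  moments of exp y.\<close>

locale Gamma_powr_law = real_distribution \<nu> for \<nu> :: "real measure" +
  fixes d :: real
  assumes d_pos: "d > 0"
    and integrable_exp: "\<And>l. l > -1/2 \<Longrightarrow> integrable \<nu> (\<lambda>y. exp (l * y))"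
    and integral_exp: "\<And>l. l > -1/2 \<Longrightarrow> (\<integral>y. exp (l * y) \<partial>\<nu>) = Gamma (1 + l) powr d"
begin

text \<open>On the real axis \<open>exp (d * ln_Gamma (1 + l))\<close> is the ordinary real power.
  Continuation from there follows exactly the branch of the logarithm that \<open>Gamma_powr\<close>
  uses.\<close>

lemma integral_exp_complex:
  assumes "Re z > -1/2"
  shows "(\<integral>y. exp (z * complex_of_real y) \<partial>\<nu>) = Gamma_powr (1 + z) d"
  unfolding Gamma_powr_def
proof (rule laplace_transform_eqI[where a = "-1/2" and b = "Re z + 1"])
  show "(\<lambda>z. exp (complex_of_real d * ln_Gamma (1 + z))) holomorphic_on {w. -1/2 < Re w \<and> Re w < Re z + 1}"
    by (intro holomorphic_intros holomorphic_on_compose_gen[of "\<lambda>z. 1 + z" _ ln_Gamma "- \<real>\<^sub>\<le>\<^sub>0", unfolded o_def])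
       (auto simp: complex_nonpos_Reals_iff intro: ln_Gamma_branch(1))
  fix l :: real assume l: "-1/2 < l"
  have "complex_of_real d * ln_Gamma (1 + complex_of_real l) = of_real (d * ln_Gamma (1 + l))"
    using l ln_Gamma_complex_of_real[of "1 + l"] by simp
  moreover have "Gamma (1 + l) powr d = exp (d * ln_Gamma (1 + l))"
    using l by (simp add: Gamma_real_pos_exp powr_def)
  ultimately show "complex_of_real (\<integral>y. exp (l * y) \<partial>\<nu>) = exp (complex_of_real d * ln_Gamma (1 + complex_of_real l))"
    by (simp only: integral_exp[OF l] exp_of_real)
qed (use assms integrable_exp in auto)

lemma e_integrand_eq:
  assumes "t > 0"
  shows "e_integrand (d + 1) t x
    = (\<integral>y. (iexp (x * (ln t - y)) * Gamma (1 - \<i> * of_real x)) / of_real t \<partial>\<nu>)"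
proof -
  have "1 - \<i> * complex_of_real x \<notin> \<real>\<^sub>\<le>\<^sub>0"
    by (simp add: complex_nonpos_Reals_iff)
  hence "Gamma_powr (1 - \<i> * of_real x) (d + 1) = Gamma_powr (1 + (- \<i> * of_real x)) d * Gamma (1 - \<i> * of_real x)"
    using ln_Gamma_branch(2)[of "1 - \<i> * of_real x"] by (simp add: Gamma_powr_def ring_distribs exp_add)
  also have "Gamma_powr (1 + (- \<i> * of_real x)) d = (\<integral>y. exp (- \<i> * of_real x * complex_of_real y) \<partial>\<nu>)"
    by (subst integral_exp_complex) auto
  finally have "e_integrand (d + 1) t x
      = (iexp (x * ln t) * Gamma (1 - \<i> * of_real x) / of_real t) * (\<integral>y. exp (- \<i> * of_real x * complex_of_real y) \<partial>\<nu>)"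
    using assms by (simp add: e_integrand_def powr_def Ln_of_real exp_diff exp_of_real ring_distribs mult_ac)
  also have "\<dots> = (\<integral>y. (iexp (x * ln t) * Gamma (1 - \<i> * of_real x) / of_real t) * exp (- \<i> * of_real x * complex_of_real y) \<partial>\<nu>)"
    by (rule integral_mult_right_zero [symmetric])
  also have "\<dots> = (\<integral>y. (iexp (x * (ln t - y)) * Gamma (1 - \<i> * of_real x)) / of_real t \<partial>\<nu>)"
    by (intro Bochner_Integration.integral_cong refl) (simp add: ring_distribs exp_diff exp_minus field_simps)
  finally show ?thesis .
qed

text \<open>The multiplicative convolution of the law of \<open>exp y\<close> under \<open>\<nu>\<close> with the exponential
  distribution, which corresponds to $\Gamma^{d+1} = \Gamma^d\,\Gamma$ on the Mellin side.\<close>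

lemma e_fun_eq:
  assumes "t > 0"
  shows "e_fun (d + 1) t = (\<integral>y. exp (- y) * exp (- (exp (- y) * t)) \<partial>\<nu>)"
proof -
  interpret P: pair_sigma_finite lborel \<nu> ..
  define G where "G = (\<lambda>x. Gamma (1 - \<i> * complex_of_real x))"
  have G: "integrable lborel G" unfolding G_def by (rule integrable_Gamma_vertical)
  hence [measurable]: "G \<in> borel_measurable borel" by auto
  let ?F = "\<lambda>x y. (iexp (x * (ln t - y)) * G x) / of_real t"
  have "(\<integral>x. e_integrand (d + 1) t x \<partial>lborel) = (\<integral>x. \<integral>y. ?F x y \<partial>\<nu> \<partial>lborel)"
    unfolding G_def by (simp only: e_integrand_eq[OF assms])
  also have "\<dots> = (\<integral>y. \<integral>x. ?F x y \<partial>lborel \<partial>\<nu>)"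
  \<comment> \<open>The factor \<open>iexp\<close> has modulus 1 and \<nu> has mass 1, so absolute
    integrability reduces to that of Gamma on the vertical line.\<close>
  proof (rule P.Fubini_integral [symmetric], rule P.Fubini_integrable)
    show "(\<lambda>(x, y). ?F x y) \<in> borel_measurable (lborel \<Otimes>\<^sub>M \<nu>)" by measurable
    have "(\<lambda>x. \<integral>y. norm (case (x, y) of (x, y) \<Rightarrow> ?F x y) \<partial>\<nu>) = (\<lambda>x. norm (G x) / t)"
      using assms prob_space by (simp add: norm_mult norm_divide)
    moreover have "integrable lborel (\<lambda>x. norm (G x) / t)" using G by simp
    ultimately show "integrable lborel (\<lambda>x. \<integral>y. norm (case (x, y) of (x, y) \<Rightarrow> ?F x y) \<partial>\<nu>)"
      by (simp only:)
    have "integrable \<nu> (\<lambda>y. ?F x y)" for x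
      by (rule integrable_const_bound[where B = "norm (G x) / t"]) (use assms in \<open>auto simp: norm_mult norm_divide\<close>)
    thus "AE x in lborel. integrable \<nu> (\<lambda>y. case (x, y) of (x, y) \<Rightarrow> ?F x y)" by simp
  qed
  also have "\<dots> = (\<integral>y. complex_of_real (2 * pi * (exp (- y) * exp (- (exp (- y) * t)))) \<partial>\<nu>)"
  proof (intro Bochner_Integration.integral_cong refl)
    fix y
    have "(\<integral>x. ?F x y \<partial>lborel) = (\<integral>x. iexp (x * (ln t - y)) * G x \<partial>lborel) / of_real t"
      by (rule integral_divide_zero)
    also have "\<dots> = complex_of_real (2 * pi * log_exp_density (ln t - y) / t)"
      unfolding G_def Gamma_vertical_fourier_inversion by simp
    also have "log_exp_density (ln t - y) = t * (exp (- y) * exp (- (exp (- y) * t)))"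
    proof -
      have "exp (ln t - y) = exp (- y) * t"
        using assms by (simp add: exp_diff exp_minus divide_inverse mult.commute)
      moreover have "log_exp_density (ln t - y) = exp (ln t - y) * exp (- exp (ln t - y))"
        by (simp add: log_exp_density_def mult_exp_exp)
      ultimately show ?thesis by simp
    qed
    finally show "(\<integral>x. ?F x y \<partial>lborel) = complex_of_real (2 * pi * (exp (- y) * exp (- (exp (- y) * t))))"
      using assms by simp
  qed
  also have "\<dots> = complex_of_real (2 * pi * (\<integral>y. exp (- y) * exp (- (exp (- y) * t)) \<partial>\<nu>))"
    by (simp only: integral_complex_of_real integral_mult_right_zero)
  finally show ?thesis by (simp add: e_fun_def)
qed

text \<open>With x = exp(-y), the inequality u <= exp u at u = x t gives x exp(-x t) <= 1/t. The
  product has to be bounded as a whole, since exp(-y) by itself is the exponent l = -1, outside the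
  range of \<open>integrable_exp\<close>.\<close>

lemma integrable_exponential_mixture:
  assumes "t > 0"
  shows "integrable \<nu> (\<lambda>y. exp (- y) * exp (- (exp (- y) * t)))"
proof (rule integrable_const_bound[where B = "1 / t"])
  have "exp (- y) * t \<le> exp (exp (- y) * t)" for y
    using exp_ge_add_one_self[of "exp (- y) * t"] by linarith
  hence "exp (- y) * exp (- (exp (- y) * t)) \<le> 1 / t" for y
    using assms by (simp add: exp_minus field_simps)
  thus "AE y in \<nu>. norm (exp (- y) * exp (- (exp (- y) * t))) \<le> 1 / t" by simp
qed simp

lemma e_fun_measurable: "(\<lambda>t. indicator {0<..} t * e_fun (d + 1) t) \<in> borel_measurable borel"
proof -
  have "(\<lambda>t. indicator {0<..} t * (\<integral>y. exp (- y) * exp (- (exp (- y) * t)) \<partial>\<nu>)) \<in> borel_measurable borel"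
    by measurable
  also have "(\<lambda>t. indicator {0<..} t * (\<integral>y. exp (- y) * exp (- (exp (- y) * t)) \<partial>\<nu>))
      = (\<lambda>t. indicator {0<..} t * e_fun (d + 1) t)"
    by (auto simp: fun_eq_iff indicator_def e_fun_eq)
  finally show ?thesis .
qed

lemma e_fun_nonneg: "t > 0 \<Longrightarrow> e_fun (d + 1) t \<ge> 0"
  by (simp add: e_fun_eq)

text \<open>By Tonelli the t-integral may be taken inside: the exponential law with mean exp y
  contributes its n-th moment n! exp(n y), and the \<nu>-mean of this is finite.\<close>

lemma integrable_moments_e_fun:
  "integrable lborel (\<lambda>t. indicator {0<..} t * e_fun (d + 1) t * t ^ n)"
proof (rule integrableI_bounded)
  note [measurable] = e_fun_measurable
  show "(\<lambda>t. indicator {0<..} t * e_fun (d + 1) t * t ^ n) \<in> borel_measurable lborel" by measurable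
  interpret P: pair_sigma_finite lborel \<nu> ..
  let ?g = "\<lambda>t y. indicator {0<..} t * t ^ n * (exp (- y) * exp (- (exp (- y) * t)))"
  have "(\<integral>\<^sup>+t. ennreal (norm (indicator {0<..} t * e_fun (d + 1) t * t ^ n)) \<partial>lborel)
      = (\<integral>\<^sup>+t. \<integral>\<^sup>+y. ennreal (?g t y) \<partial>\<nu> \<partial>lborel)"
  proof (intro nn_integral_cong)
    fix t :: real
    show "ennreal (norm (indicator {0<..} t * e_fun (d + 1) t * t ^ n)) = (\<integral>\<^sup>+y. ennreal (?g t y) \<partial>\<nu>)"
    proof (cases "t > 0")
      case True
      have "(\<integral>\<^sup>+y. ennreal (?g t y) \<partial>\<nu>) = ennreal (\<integral>y. ?g t y \<partial>\<nu>)"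
        using True integrable_exponential_mixture[OF True] by (intro nn_integral_eq_integral) auto
      thus ?thesis using True e_fun_nonneg[OF True] by (simp add: e_fun_eq[OF True] mult.commute)
    qed simp
  qed
  also have "\<dots> = (\<integral>\<^sup>+y. \<integral>\<^sup>+t. ennreal (?g t y) \<partial>lborel \<partial>\<nu>)"
    by (rule P.Fubini' [symmetric]) measurable
  also have "\<dots> = (\<integral>\<^sup>+y. ennreal (fact n) * ennreal (exp (n * y)) \<partial>\<nu>)"
  proof (intro nn_integral_cong)
    fix y :: real
    have "(\<integral>\<^sup>+t. ennreal (?g t y) \<partial>lborel)
        = (\<integral>\<^sup>+t. ennreal (exp (- y)) * ennreal (indicator {0..} t * t powr ((real n + 1) - 1) * exp (- (exp (- y) * t))) \<partial>lborel)"
      using AE_lborel_singleton[of "0::real"]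
      by (intro nn_integral_cong_AE, eventually_elim)
         (auto simp: indicator_def powr_realpow mult_ac simp flip: ennreal_mult)
    also have "\<dots> = ennreal (exp (- y)) * ennreal (Gamma (real n + 1) * exp (- y) powr (- (real n + 1)))"
      by (subst nn_integral_cmult, measurable) (subst nn_integral_powr_exp, auto)
    also have "\<dots> = ennreal (exp (- y) * (Gamma (real n + 1) * exp (- y) powr (- (real n + 1))))"
      by (simp add: ennreal_mult')
    also have "Gamma (real n + 1) = fact n"
      using Gamma_fact[of n, where 'a = real] by (simp add: add.commute)
    also have "exp (- y) * (fact n * exp (- y) powr (- (real n + 1))) = fact n * exp (n * y)"
      by (simp add: powr_def mult_exp_exp algebra_simps)
    finally show "(\<integral>\<^sup>+t. ennreal (?g t y) \<partial>lborel) = ennreal (fact n) * ennreal (exp (n * y))"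
      by (simp add: ennreal_mult')
  qed
  also have "\<dots> = ennreal (fact n) * (\<integral>\<^sup>+y. ennreal (exp (n * y)) \<partial>\<nu>)"
    by (rule nn_integral_cmult) measurable
  also have "(\<integral>\<^sup>+y. ennreal (exp (n * y)) \<partial>\<nu>) = ennreal (\<integral>y. exp (n * y) \<partial>\<nu>)"
    by (intro nn_integral_eq_integral integrable_exp) auto
  finally show "(\<integral>\<^sup>+t. ennreal (norm (indicator {0<..} t * e_fun (d + 1) t * t ^ n)) \<partial>lborel) < \<infinity>"
    by (simp add: ennreal_mult_less_top)
qed

text \<open>A Paley--Zygmund argument: with \<open>X = exp y\<close>, the integrand dominates on \<open>X > s\<close> a
  combination of powers of \<open>X\<close>, because \<open>(1 - \<epsilon> X ^ (n + 1))\<^sup>2 \<ge> 0\<close>.\<close>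

lemma e_fun_ge_moments:
  assumes "t > 0" "s > 0" "s ^ n \<le> fact n powr d / 2"
  shows "e_fun (d + 1) t \<ge> exp (- t / s) * ((fact n powr d)\<^sup>2 / (4 * fact (2 * n + 1) powr d))"
proof -
  have mom: "integrable \<nu> (\<lambda>y. exp y ^ k)" "(\<integral>y. exp y ^ k \<partial>\<nu>) = fact k powr d" for k
    using integrable_exp[of "real k"] integral_exp[of "real k"] Gamma_fact[of k, where 'a = real]
    by (simp_all add: exp_of_nat_mult)
  define A where "A = (fact n powr d :: real)"
  define B where "B = (fact (2 * n + 1) powr d :: real)"
  have AB: "A > 0" "B > 0" by (auto simp: A_def B_def)
  \<comment> \<open>This value maximises \<epsilon> A - \<epsilon>^2 B, which remains after s^n is
    replaced by its upper bound A/2; the maximum is A^2 / (4 B).\<close>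
  define \<epsilon> where "\<epsilon> = A / (2 * B)"
  have \<epsilon>: "\<epsilon> > 0" using AB by (simp add: \<epsilon>_def)
  have "A\<^sup>2 / (4 * B) = 2 * \<epsilon> * (A - A / 2) - \<epsilon>\<^sup>2 * B"
    using AB by (simp add: \<epsilon>_def power2_eq_square field_simps)
  also have "\<dots> \<le> 2 * \<epsilon> * (A - s ^ n) - \<epsilon>\<^sup>2 * B"
    using assms(3) \<epsilon> by (intro diff_mono mult_left_mono) (auto simp: A_def)
  finally have "exp (- t / s) * (A\<^sup>2 / (4 * B)) \<le> exp (- t / s) * (2 * \<epsilon> * (A - s ^ n) - \<epsilon>\<^sup>2 * B)"
    by (intro mult_left_mono) auto
  also have "\<dots> = (\<integral>y. exp (- t / s) * (2 * \<epsilon> * (exp y ^ n - s ^ n) - \<epsilon>\<^sup>2 * exp y ^ (2 * n + 1)) \<partial>\<nu>)"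
    using mom[of n] mom[of "2 * n + 1"] prob_space by (simp del: power_Suc add: A_def B_def)
  also have "\<dots> \<le> (\<integral>y. exp (- y) * exp (- (exp (- y) * t)) \<partial>\<nu>)"
  proof (rule integral_mono)
    show "integrable \<nu> (\<lambda>y. exp (- t / s) * (2 * \<epsilon> * (exp y ^ n - s ^ n) - \<epsilon>\<^sup>2 * exp y ^ (2 * n + 1)))"
      using mom(1)[of n] mom(1)[of "2 * n + 1"] by (simp del: power_Suc)
    fix y :: real
    define X where "X = exp y"
    have X: "X > 0" by (simp add: X_def)
    show "exp (- t / s) * (2 * \<epsilon> * (exp y ^ n - s ^ n) - \<epsilon>\<^sup>2 * exp y ^ (2 * n + 1)) \<le> exp (- y) * exp (- (exp (- y) * t))"
    proof (cases "X \<le> s")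
      case True
      \<comment> \<open>Subtracting s^n makes the comparison function nonpositive here, so the
        components with X <= s are simply discarded.\<close>
      hence "X ^ n \<le> s ^ n" using X by (intro power_mono) auto
      hence "2 * \<epsilon> * (X ^ n - s ^ n) \<le> 0" using \<epsilon> by (simp add: mult_nonneg_nonpos)
      moreover have "\<epsilon>\<^sup>2 * X ^ (2 * n + 1) \<ge> 0" using X by simp
      ultimately have "exp (- t / s) * (2 * \<epsilon> * (X ^ n - s ^ n) - \<epsilon>\<^sup>2 * X ^ (2 * n + 1)) \<le> 0"
        by (intro mult_nonneg_nonpos) auto
      also have "0 \<le> exp (- y) * exp (- (exp (- y) * t))" by simp
      finally show ?thesis by (simp only: X_def)
    next
      case False
      define P where "P = X ^ n"
      have P: "X ^ n = P" "X ^ (2 * n + 1) = P * P * X"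
        by (simp_all add: P_def power_add mult_2)
      \<comment> \<open>Division by X isolates the weight 1/X = exp(-y) of the integrand and lowers
        the top degree from 2 n + 2 to 2 n + 1; this is the source of the odd moment.\<close>
      have "0 \<le> (1 - \<epsilon> * (P * X))\<^sup>2 / X" using X by simp
      also have "\<dots> = 1 / X - (2 * \<epsilon> * P - \<epsilon>\<^sup>2 * (P * P * X))"
        using X by (simp add: field_simps power2_eq_square)
      also have "\<dots> = 1 / X - (2 * \<epsilon> * X ^ n - \<epsilon>\<^sup>2 * X ^ (2 * n + 1))"
        by (simp only: P)
      finally have "2 * \<epsilon> * X ^ n - \<epsilon>\<^sup>2 * X ^ (2 * n + 1) \<le> 1 / X" by simp
      moreover have "2 * \<epsilon> * (X ^ n - s ^ n) \<le> 2 * \<epsilon> * X ^ n"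
        using \<epsilon> assms(2) by (intro mult_left_mono) auto
      ultimately have "2 * \<epsilon> * (X ^ n - s ^ n) - \<epsilon>\<^sup>2 * X ^ (2 * n + 1) \<le> 1 / X" by linarith
      hence "exp (- t / s) * (2 * \<epsilon> * (X ^ n - s ^ n) - \<epsilon>\<^sup>2 * X ^ (2 * n + 1)) \<le> exp (- t / s) * (1 / X)"
        by (intro mult_left_mono) auto
      also have "\<dots> \<le> exp (- t / X) * (1 / X)"
        using False X assms by (intro mult_right_mono) (auto simp: divide_left_mono)
      also have "\<dots> = exp (- y) * exp (- (exp (- y) * t))"
        by (simp add: X_def exp_minus field_simps)
      finally show ?thesis by (simp only: X_def)
    qed
  qed (rule integrable_exponential_mixture[OF assms(1)])
  finally show ?thesis by (simp add: e_fun_eq[OF assms(1)] A_def B_def)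
qed

text \<open>With n of order t^(1/(d+1)) and s a small multiple of n^d, the condition s^n <= (n!)^d /
  2 holds and t / s is at most a constant times n. The moment quotient is also at least exponential
  in -n, so the whole bound has the form exp(-K n).\<close>

lemma e_fun_lower_bound:
  obtains K where "K > 0"
    "\<And>t. t > 0 \<Longrightarrow> e_fun (d + 1) t \<ge> exp (- K) / 4 * exp (- K * t powr (1 / (d + 1)))"
proof -
  \<comment> \<open>The first summand bounds t / (s n), the second is the rate in the comparison of
    the two factorials.\<close>
  define K where "K = 2 * 3 powr d + d * ln 12"
  have K: "K > 0" using d_pos by (auto simp: K_def intro!: add_pos_pos)
  moreover have "e_fun (d + 1) t \<ge> exp (- K) / 4 * exp (- K * t powr (1 / (d + 1)))" if t: "t > 0" for t
  proof -
    \<comment> \<open>Rounding up ensures n >= 1 and adds at most 1 to the exponent's argument,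
      which accounts for the factor exp(-K) in front.\<close>
    define n where "n = nat \<lceil>t powr (1 / (d + 1))\<rceil>"
    have "t powr (1 / (d + 1)) > 0" using t by simp
    hence n: "n \<ge> 1" "t powr (1 / (d + 1)) \<le> n" "n \<le> t powr (1 / (d + 1)) + 1"
      unfolding n_def by linarith+
    \<comment> \<open>The n-th power of (n/3)^d is at most (n!)^d, and halving the base contributes
      2^(-n) <= 1/2.\<close>
    define s where "s = (real n / 3) powr d / 2"
    have s: "s > 0" using n by (simp add: s_def)
    have "s ^ n = ((real n / 3) ^ n) powr d / 2 ^ n"
    proof -
      have "((real n / 3) powr d) ^ n = ((real n / 3) powr d) powr real n"
        using n by (intro powr_realpow [symmetric]) auto
      also have "\<dots> = ((real n / 3) powr real n) powr d"
        by (simp only: powr_powr mult.commute)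
      also have "(real n / 3) powr real n = (real n / 3) ^ n"
        using n by (intro powr_realpow) auto
      finally show ?thesis by (simp only: s_def power_divide)
    qed
    also have "\<dots> \<le> fact n powr d / 2 ^ n"
      using d_pos by (intro divide_right_mono powr_mono2 power_div_3_le_fact) auto
    also have "\<dots> \<le> fact n powr d / 2"
      using n self_le_power[of "2::real" n] by (intro divide_left_mono) auto
    finally have sn: "s ^ n \<le> fact n powr d / 2" .
    have "t = (t powr (1 / (d + 1))) powr (d + 1)"
      using t d_pos by (simp add: powr_powr)
    also have "\<dots> \<le> real n powr (d + 1)"
      using n d_pos by (intro powr_mono2) auto
    also have "\<dots> = (2 * 3 powr d * n) * s"
      using n by (simp add: s_def powr_add powr_divide)
    finally have ts: "t / s \<le> 2 * 3 powr d * n"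
      using s by (simp add: divide_le_eq)
    define M where "M = (fact (2 * n + 1) powr d :: real)"
    define F where "F = ((fact n powr d)\<^sup>2 :: real)"
    have MF: "M > 0" "F > 0" by (auto simp: M_def F_def)
    have "M \<le> (12 ^ n * (fact n)\<^sup>2 :: real) powr d"
      unfolding M_def using d_pos fact_double_le[of n] by (intro powr_mono2) auto
    also have "\<dots> = exp (d * ln 12 * n) * F"
      unfolding F_def by (simp add: powr_mult powr_power mult.commute) (simp add: powr_def ln_realpow mult_ac)
    finally have "M \<le> exp (d * ln 12 * n) * F" .
    hence f: "exp (- (d * ln 12 * n)) / 4 \<le> F / (4 * M)"
      using MF by (simp add: exp_minus field_simps)
    have "exp (- K) / 4 * exp (- K * t powr (1 / (d + 1))) = exp (- K * (t powr (1 / (d + 1)) + 1)) / 4"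
      by (simp add: ring_distribs exp_add exp_diff exp_minus field_simps)
    also have "\<dots> \<le> exp (- K * n) / 4"
      using n K by simp
    also have "\<dots> = exp (- (2 * 3 powr d * n)) * (exp (- (d * ln 12 * n)) / 4)"
      by (simp add: K_def ring_distribs mult_exp_exp)
    also have "\<dots> \<le> exp (- t / s) * (exp (- (d * ln 12 * n)) / 4)"
      using ts by (intro mult_right_mono) auto
    also have "\<dots> \<le> exp (- t / s) * (F / (4 * M))"
      using f by (intro mult_left_mono) auto
    also have "\<dots> \<le> e_fun (d + 1) t"
      unfolding F_def M_def by (rule e_fun_ge_moments[OF t s sn])
    finally show ?thesis .
  qed
  ultimately show ?thesis using that by blast
qed

end

section \<open>A perturbation with vanishing moments\<close>

lemma has_bochner_integral_power_exp_powr: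
  fixes \<alpha> a :: real
  assumes "\<alpha> > 0" "a > 0"
  shows "has_bochner_integral lborel (\<lambda>t. indicator {0<..} t * t ^ n * exp (- (a * t powr \<alpha>)))
           (Gamma ((real n + 1) / \<alpha>) / \<alpha> * a powr (- ((real n + 1) / \<alpha>)))"
proof -
  define p where "p = (real n + 1) / \<alpha>"
  have p: "p > 0" using assms by (simp add: p_def)
  define f where "f = (\<lambda>t. t ^ n * exp (- (a * t powr \<alpha>)))"
  define g where "g = (\<lambda>v :: real. v powr (1 / \<alpha>))"
  define g' where "g' = (\<lambda>v :: real. 1 / \<alpha> * v powr (1 / \<alpha> - 1))"
  define h where "h = (\<lambda>v. 1 / \<alpha> * (indicator {0..} v * v powr (p - 1) * exp (- (a * v))))"
  have h: "has_bochner_integral lborel h (1 / \<alpha> * (Gamma p * a powr (- p)))"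
    unfolding h_def by (intro has_bochner_integral_mult_right has_bochner_integral_powr_exp p assms)
  have eq: "f (g v) * g' v = h v" if "v > 0" for v
  proof -
    have "g v ^ n = v powr (real n / \<alpha>)"
      using that by (simp add: g_def powr_power)
    moreover have "g v powr \<alpha> = v" using that assms by (simp add: g_def powr_powr)
    moreover have "v powr (real n / \<alpha>) * v powr (1 / \<alpha> - 1) = v powr (p - 1)"
      by (simp add: p_def add_divide_distrib add_diff_eq flip: powr_add)
    ultimately show ?thesis
      using that by (simp add: f_def h_def g'_def mult_ac)
  qed
  have ein: "einterval 0 \<infinity> = {0::real<..}" by (auto simp: einterval_iff)
  have "set_integrable lborel {0<..} h"
    unfolding set_integrable_def using h by (intro integrable_mult_indicator) (auto simp: has_bochner_integral_iff)
  hence int: "set_integrable lborel (einterval 0 \<infinity>) (\<lambda>v. f (g v) * g' v)"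
    unfolding ein by (subst set_integrable_cong[OF refl refl eq]) auto
  have *: "set_integrable lborel (einterval 0 \<infinity>) f"
    "(LBINT t=0..\<infinity>. f t) = (LBINT v=0..\<infinity>. f (g v) * g' v)"
  proof -
    have A: "((ereal \<circ> g \<circ> real_of_ereal) \<longlongrightarrow> 0) (at_right 0)"
    proof -
      have "((\<lambda>v. v powr (1 / \<alpha>)) \<longlongrightarrow> 0 powr (1 / \<alpha>)) (at_right (0::real))"
        using assms by (intro tendsto_intros) (auto simp: eventually_at_right_less eventually_at_topological)
      thus ?thesis
        unfolding zero_ereal_def by (simp add: ereal_tendsto_simps g_def)
    qed
    have B: "((ereal \<circ> g \<circ> real_of_ereal) \<longlongrightarrow> \<infinity>) (at_left \<infinity>)"
    proof -
      have "filterlim (\<lambda>v. exp (1 / \<alpha> * ln v)) at_top at_top"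
        using assms
        by (intro filterlim_compose[OF exp_at_top] filterlim_tendsto_pos_mult_at_top[OF tendsto_const _ ln_at_top]) auto
      moreover have "eventually (\<lambda>v. exp (1 / \<alpha> * ln v) = g v) at_top"
        using eventually_gt_at_top[of 0] by eventually_elim (use assms in \<open>simp add: g_def powr_def\<close>)
      ultimately have "filterlim g at_top at_top"
        using filterlim_cong by fast
      thus ?thesis by (simp add: ereal_tendsto_simps)
    qed
    note sub = interval_integral_substitution_nonneg[OF _ _ _ _ _ _ A B int]
    have "DERIV g v :> g' v" "isCont g' v" "isCont f (g v)" "0 \<le> f (g v)" if "v > 0" for v
      using that assms by (auto intro!: derivative_eq_intros continuous_intros simp: f_def g_def g'_def)
    moreover have "0 \<le> g' v" for v using assms by (simp add: g'_def)
    ultimately show "set_integrable lborel (einterval 0 \<infinity>) f"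
      "(LBINT t=0..\<infinity>. f t) = (LBINT v=0..\<infinity>. f (g v) * g' v)"
      by (auto intro!: sub)
  qed
  have "(LBINT t=0..\<infinity>. f t) = (\<integral>t. indicator {0<..} t * f t \<partial>lborel)"
    by (simp add: interval_lebesgue_integral_def ein set_lebesgue_integral_def)
  moreover have "(LBINT v=0..\<infinity>. f (g v) * g' v) = (\<integral>v. h v \<partial>lborel)"
    unfolding interval_lebesgue_integral_def ein set_lebesgue_integral_def
  proof (simp, rule integral_cong_AE)
    show "AE v in lborel. indicat_real {0<..} v * (f (g v) * g' v) = h v"
      using AE_lborel_singleton[of "0::real"]
    proof eventually_elim
      fix v :: real assume "v \<noteq> 0"
      thus "indicat_real {0<..} v * (f (g v) * g' v) = h v"
        using eq[of v] by (cases "v > 0") (auto simp: h_def)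
    qed
  qed (simp_all add: f_def h_def g_def g'_def)
  ultimately have "has_bochner_integral lborel (\<lambda>t. indicator {0<..} t * f t) (1 / \<alpha> * (Gamma p * a powr (- p)))"
    using * h by (simp add: has_bochner_integral_iff set_integrable_def ein)
  thus ?thesis by (simp add: f_def p_def mult_ac)
qed

text \<open>This is -Im exp(-w t^\<alpha>) on the positive half-line, with w = b (1 + i tan(pi
  \<alpha>)). For \<alpha> = 1/4 and b = 1 it is Stieltjes's classical function exp(-t^(1/4))
  sin(t^(1/4)).\<close>

definition oscillation :: "real \<Rightarrow> real \<Rightarrow> real \<Rightarrow> real" where
  "oscillation \<alpha> b t = indicator {0<..} t * exp (- (b * t powr \<alpha>)) * sin (b * tan (pi * \<alpha>) * t powr \<alpha>)"

lemma oscillation_measurable [measurable]: "oscillation \<alpha> b \<in> borel_measurable borel"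
  by (simp add: oscillation_def [abs_def])

lemma abs_oscillation_le: "\<bar>oscillation \<alpha> b t\<bar> \<le> indicator {0<..} t * exp (- (b * t powr \<alpha>))"
  by (auto simp: oscillation_def abs_mult indicator_def)

text \<open>The integral over \<open>t ^ n * exp (- w * t powr \<alpha>)\<close> is a real multiple of $w^{-(n+1)/\alpha}$, which is
  real for \<open>w = b * (1 + \<i> * tan (pi * \<alpha>))\<close>, a number with argument \<open>pi * \<alpha>\<close>.\<close>

lemma oscillation_moments:
  assumes "0 < \<alpha>" "\<alpha> < 1/2" "b > 0"
  shows "has_bochner_integral lborel (\<lambda>t. oscillation \<alpha> b t * t ^ n) 0"
proof -
  define p where "p = (real n + 1) / \<alpha>"
  \<comment> \<open>Pushing t^n dt forward under t^\<alpha> turns the moment integral into a Laplace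
    transform in y = t^\<alpha>, so continuation from negative real exponents applies.\<close>
  define D where "D = density lborel (\<lambda>t. ennreal (indicator {0<..} t * t ^ n))"
  define M where "M = distr D borel (\<lambda>t. t powr \<alpha>)"
  have meas [measurable]: "(\<lambda>t::real. t powr \<alpha>) \<in> measurable D borel" by (simp add: D_def)
  have nonneg: "AE t in lborel. 0 \<le> indicator {0<..} t * (t::real) ^ n" by (auto simp: indicator_def)
  have int: "integrable M (\<lambda>y. exp (l * y))"
    and val: "(\<integral>y. exp (l * y) \<partial>M) = Gamma p / \<alpha> * (- l) powr (- p)" if "l < 0" for l
  proof -
    have hb: "has_bochner_integral lborel (\<lambda>t. indicator {0<..} t * t ^ n * exp (l * t powr \<alpha>)) (Gamma p / \<alpha> * (- l) powr (- p))"
      using has_bochner_integral_power_exp_powr[OF assms(1), of "- l" n] that by (simp add: p_def)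
    have "integrable M (\<lambda>y. exp (l * y)) \<longleftrightarrow> integrable D (\<lambda>t. exp (l * t powr \<alpha>))"
      unfolding M_def by (rule integrable_distr_eq[OF meas]) simp
    also have "\<dots> \<longleftrightarrow> integrable lborel (\<lambda>t. (indicator {0<..} t * t ^ n) *\<^sub>R exp (l * t powr \<alpha>))"
      unfolding D_def by (rule integrable_density) (use nonneg in auto)
    finally show "integrable M (\<lambda>y. exp (l * y))"
      using hb by (simp add: has_bochner_integral_iff)
    have "(\<integral>y. exp (l * y) \<partial>M) = (\<integral>t. exp (l * t powr \<alpha>) \<partial>D)"
      unfolding M_def by (rule integral_distr[OF meas]) simp
    also have "\<dots> = (\<integral>t. (indicator {0<..} t * t ^ n) *\<^sub>R exp (l * t powr \<alpha>) \<partial>lborel)"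
      unfolding D_def by (rule integral_density) (use nonneg in auto)
    finally show "(\<integral>y. exp (l * y) \<partial>M) = Gamma p / \<alpha> * (- l) powr (- p)"
      using hb by (simp add: has_bochner_integral_iff)
  qed
  define z where "z = - (complex_of_real b * (1 + \<i> * of_real (tan (pi * \<alpha>))))"
  have z: "Re z = - b" "Im z = - (b * tan (pi * \<alpha>))" by (simp_all add: z_def)
  have cos: "cos (pi * \<alpha>) > 0"
    using assms by (intro cos_gt_zero_pi) (auto simp: field_simps intro: less_trans[of _ 0])
  have mz: "- z = of_real (b / cos (pi * \<alpha>)) * cis (pi * \<alpha>)"
    using cos by (simp add: z_def complex_eq_iff tan_def)
  \<comment> \<open>The argument pi \<alpha> is within the range of the principal logarithm, so the
    power with exponent -(n+1)/\<alpha> has argument exactly -pi (n+1) and is real.\<close>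
  have Ln: "Ln (- z) = of_real (ln (b / cos (pi * \<alpha>))) + \<i> * of_real (pi * \<alpha>)"
  proof -
    have "- z = exp (of_real (ln (b / cos (pi * \<alpha>))) + \<i> * of_real (pi * \<alpha>))"
      using cos assms by (simp add: mz exp_add cis_conv_exp exp_of_real)
    moreover have "- pi < pi * \<alpha>" "pi * \<alpha> \<le> pi"
      using assms by (auto intro: less_trans[of _ 0])
    ultimately show ?thesis by (simp add: Ln_exp)
  qed
  have "(\<integral>y. exp (z * complex_of_real y) \<partial>M) = of_real (Gamma p / \<alpha>) * (- z) powr (of_real (- p))"
  proof (rule laplace_transform_eqI[where a = "- 2 * b" and b = 0])
    show "(\<lambda>z. of_real (Gamma p / \<alpha>) * (- z) powr (of_real (- p))) holomorphic_on {w. - 2 * b < Re w \<and> Re w < 0}"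
      by (intro holomorphic_intros) (auto simp: complex_nonpos_Reals_iff)
    show "complex_of_real (\<integral>y. exp (l * y) \<partial>M) = of_real (Gamma p / \<alpha>) * (- of_real l) powr (of_real (- p))"
      if "l < 0" for l
      using that val[OF that] powr_of_real[of "- l" "- p"] by simp
  qed (use int z assms in \<open>auto simp: M_def\<close>)
  moreover have "(- z) powr (of_real (- p)) = of_real ((b / cos (pi * \<alpha>)) powr (- p) * cos (pi * (real n + 1)))"
  proof -
    have "of_real (- p) * Ln (- z) = of_real (- p * ln (b / cos (pi * \<alpha>))) + \<i> * of_real (- (pi * (real n + 1)))"
      using assms by (simp add: Ln p_def field_simps)
    moreover have "sin (pi * (real n + 1)) = 0"
      using sin_npi2[of "Suc n"] by (simp add: add.commute)
    moreover have "- z \<noteq> 0" using z assms by (auto simp: complex_eq_iff)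
    ultimately show ?thesis
      using cos assms by (simp only: powr_def exp_add exp_of_real if_False flip: cis_conv_exp) 
        (simp add: complex_eq_iff powr_def)
  qed
  ultimately have "Im (\<integral>y. exp (z * complex_of_real y) \<partial>M) = 0" by simp
  moreover have intz: "integrable M (\<lambda>y. exp (z * complex_of_real y))"
    using int[of "- b"] assms by (intro integrable_exp_cmult) (auto simp: M_def z)
  ultimately have "(\<integral>y. Im (exp (z * complex_of_real y)) \<partial>M) = 0" by simp
  moreover have im: "Im (exp (z * complex_of_real y)) = - (exp (- (b * y)) * sin (b * tan (pi * \<alpha>) * y))" for y
    by (simp add: Im_exp z)
  ultimately have "0 = (\<integral>y. exp (- (b * y)) * sin (b * tan (pi * \<alpha>) * y) \<partial>M)" by simp
  also have "\<dots> = (\<integral>t. exp (- (b * t powr \<alpha>)) * sin (b * tan (pi * \<alpha>) * t powr \<alpha>) \<partial>D)"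
    unfolding M_def by (rule integral_distr[OF meas]) simp
  also have "\<dots> = (\<integral>t. (indicator {0<..} t * t ^ n) *\<^sub>R (exp (- (b * t powr \<alpha>)) * sin (b * tan (pi * \<alpha>) * t powr \<alpha>)) \<partial>lborel)"
    unfolding D_def by (rule integral_density) (use nonneg in auto)
  finally have "(\<integral>t. oscillation \<alpha> b t * t ^ n \<partial>lborel) = 0" by (simp add: oscillation_def mult_ac)
  moreover have "integrable lborel (\<lambda>t. oscillation \<alpha> b t * t ^ n)"
  proof (rule Bochner_Integration.integrable_bound)
    show "integrable lborel (\<lambda>t. indicator {0<..} t * t ^ n * exp (- (b * t powr \<alpha>)))"
      using has_bochner_integral_power_exp_powr[OF assms(1,3), of n] by (simp add: has_bochner_integral_iff)
    show "AE t in lborel. norm (oscillation \<alpha> b t * t ^ n) \<le> norm (indicator {0<..} t * t ^ n * exp (- (b * t powr \<alpha>)))"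
      by (auto simp: oscillation_def abs_mult indicator_def mult_left_le mult_left_mono)
  qed simp
  ultimately show ?thesis by (simp add: has_bochner_integral_iff)
qed

text \<open>Near 0 the argument of the sine lies in (0, 1), where the sine is positive; r is the
  point at which that argument reaches 1. The range of \<alpha> makes the tangent positive.\<close>

lemma oscillation_not_AE_zero:
  assumes "0 < \<alpha>" "\<alpha> < 1/2" "b > 0"
  shows "\<not> (AE t in lborel. oscillation \<alpha> b t = 0)"
proof
  assume ae: "AE t in lborel. oscillation \<alpha> b t = 0"
  define k where "k = b * tan (pi * \<alpha>)"
  have k: "k > 0" using assms by (auto simp: k_def intro!: mult_pos_pos tan_gt_zero)
  define r where "r = (1 / k) powr (1 / \<alpha>)"
  have r: "r > 0" using k by (simp add: r_def)
  have "oscillation \<alpha> b t \<noteq> 0" if "0 < t" "t < r" for t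
  proof -
    have "t powr \<alpha> < r powr \<alpha>" using that assms by (intro powr_less_mono2) auto
    also have "r powr \<alpha> = 1 / k" using k assms by (simp add: r_def powr_powr)
    finally have "k * t powr \<alpha> < 1" using k by (simp add: field_simps)
    moreover have "0 < k * t powr \<alpha>" using k that by simp
    ultimately have "sin (k * t powr \<alpha>) > 0" using pi_gt3 by (intro sin_gt_zero) auto
    thus ?thesis using that by (simp add: oscillation_def k_def)
  qed
  hence "AE t in lborel. t \<notin> {0<..<r}"
    using ae by (auto elim!: eventually_mono)
  hence "{0<..<r} \<in> null_sets lborel" by (subst AE_iff_null_sets) auto
  thus False using r by (auto simp: null_sets_def)
qed

section \<open>A second measure with the same moments\<close>

lemma stieltjes_measure_density:
  fixes f :: "real \<Rightarrow> real"
  assumes [measurable]: "f \<in> borel_measurable borel" and "\<And>t. f t \<ge> 0" "\<And>t. t \<le> 0 \<Longrightarrow> f t = 0"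
    and "\<And>n. integrable lborel (\<lambda>t. f t * t ^ n)"
  shows "stieltjes_measure (density lborel (\<lambda>t. ennreal (f t)))"
  unfolding stieltjes_measure_def
proof (intro conjI allI)
  have "(\<integral>\<^sup>+t. ennreal (f t) * indicator {..<0} t \<partial>lborel) = (\<integral>\<^sup>+(t::real). 0 \<partial>lborel)"
    using assms(3) by (intro nn_integral_cong) (auto simp: indicator_def)
  thus "emeasure (density lborel (\<lambda>t. ennreal (f t))) {..<0} = 0"
    by (simp add: emeasure_density)
  show "integrable (density lborel (\<lambda>t. ennreal (f t))) (\<lambda>t. t ^ n)" for n
    by (subst integrable_density) (use assms in auto)
qed simp

theorem corollary2p3:
  fixes c :: real
  assumes "c > 2"
  shows "S_indeterminate (tau c)"
proof -
  define d where "d = c - 1"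
  have d: "d > 0" "c = d + 1" using assms by (auto simp: d_def)
  obtain \<nu> where "real_distribution \<nu>"
    "\<And>l. l > -1/2 \<Longrightarrow> integrable \<nu> (\<lambda>y. exp (l * y))"
    "\<And>l. l > -1/2 \<Longrightarrow> (\<integral>y. exp (l * y) \<partial>\<nu>) = Gamma (1 + l) powr d"
    using Gamma_powr_distribution[OF d(1)] by blast
  then interpret Gamma_powr_law \<nu> d
    using d by (auto simp: Gamma_powr_law_def Gamma_powr_law_axioms_def)
  obtain K where K: "K > 0"
    "\<And>t. t > 0 \<Longrightarrow> e_fun c t \<ge> exp (- K) / 4 * exp (- K * t powr (1 / c))"
    using e_fun_lower_bound unfolding d(2) by blast
  have c: "1 / c < 1 / 2" "1 / c > 0" using assms by (auto simp: field_simps)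
  then obtain \<alpha> where \<alpha>: "1 / c < \<alpha>" "\<alpha> < 1/2"
    using dense by blast
  with less_trans[OF c(2) \<alpha>(1)] have \<alpha>: "0 < \<alpha>" "\<alpha> < 1/2" "1 / c \<le> \<alpha>" by simp_all
  define f where "f = (\<lambda>t. indicator {0<..} t * e_fun c t)"
  \<comment> \<open>The decay rate is the constant K of the lower bound, so that the two
    exponentials can be compared directly.\<close>
  define h where "h = oscillation \<alpha> K"
  \<comment> \<open>One factor exp(-K) / 4 is the prefactor of the lower bound; the other exp(-K)
    pays for the summand 1 in t^(1/c) <= 1 + t^\<alpha>.\<close>
  define \<delta> where "\<delta> = exp (- 2 * K) / 4"
  have \<delta>: "\<delta> > 0" by (simp add: \<delta>_def)
  have [measurable]: "f \<in> borel_measurable borel" "h \<in> borel_measurable borel"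
    using e_fun_measurable by (simp_all add: f_def h_def d(2))
  have f_nonneg: "f t \<ge> 0" for t
    using e_fun_nonneg by (simp add: f_def d(2) indicator_def)
  have f_int: "integrable lborel (\<lambda>t. f t * t ^ n)" for n
    using integrable_moments_e_fun by (simp add: f_def d(2))
  have h_int: "integrable lborel (\<lambda>t. h t * t ^ n)" and h_val: "(\<integral>t. h t * t ^ n \<partial>lborel) = 0" for n
    using oscillation_moments[OF \<alpha>(1,2) K(1), of n] by (simp_all add: has_bochner_integral_iff h_def)
  have bound: "\<delta> * \<bar>h t\<bar> \<le> f t" for t
  proof (cases "t > 0")
    case True
    \<comment> \<open>The comparison of the two powers reverses below t = 1, where the left-hand
      side is at most 1; the constant covers that range.\<close>
    have "t powr (1 / c) \<le> 1 + t powr \<alpha>"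
    proof (cases "t \<le> 1")
      case True
      hence "t powr (1 / c) \<le> 1" using \<open>t > 0\<close> c by (intro powr_le1) auto
      thus ?thesis by (simp add: add_increasing2)
    next
      case False
      hence "t powr (1 / c) \<le> t powr \<alpha>" using \<alpha> by (intro powr_mono) auto
      thus ?thesis by simp
    qed
    hence "K * t powr (1 / c) \<le> K * (1 + t powr \<alpha>)"
      using K by (intro mult_left_mono) auto
    hence "- 2 * K - K * t powr \<alpha> \<le> - K - K * t powr (1 / c)"
      by (simp add: algebra_simps)
    hence "exp (- 2 * K - K * t powr \<alpha>) / 4 \<le> exp (- K - K * t powr (1 / c)) / 4" by simp
    also have "\<dots> = exp (- K) / 4 * exp (- K * t powr (1 / c))"
      by (simp add: mult_exp_exp)
    also have "\<dots> \<le> f t" using K(2)[OF True] True by (simp add: f_def)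
    finally have "\<delta> * exp (- (K * t powr \<alpha>)) \<le> f t"
      by (simp add: \<delta>_def mult_exp_exp)
    moreover have "\<delta> * \<bar>h t\<bar> \<le> \<delta> * exp (- (K * t powr \<alpha>))"
      using abs_oscillation_le[of \<alpha> K t] \<delta> True by (simp add: h_def)
    ultimately show ?thesis by linarith
  qed (simp add: h_def oscillation_def f_def)
  define g where "g = (\<lambda>t. f t + \<delta> * h t)"
  have g_nonneg: "g t \<ge> 0" for t
  proof -
    have "- \<delta> * h t \<le> \<delta> * \<bar>h t\<bar>" using \<delta> by (simp add: abs_if)
    with bound[of t] show ?thesis by (simp add: g_def)
  qed
  have [measurable]: "g \<in> borel_measurable borel" by (simp add: g_def)
  have g_eq: "(\<lambda>t. g t * t ^ n) = (\<lambda>t. f t * t ^ n + \<delta> * (h t * t ^ n))" for n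
    by (simp add: g_def algebra_simps)
  have g_int: "integrable lborel (\<lambda>t. g t * t ^ n)" for n
    unfolding g_eq using f_int h_int by simp
  have zero: "f t = 0" "g t = 0" if "t \<le> 0" for t
    using that by (simp_all add: g_def f_def h_def oscillation_def)
  have tau: "tau c = density lborel (\<lambda>t. ennreal (f t))"
    by (simp add: tau_def f_def)
  let ?N = "density lborel (\<lambda>t. ennreal (g t))"
  have "stieltjes_measure (tau c)" unfolding tau
    by (rule stieltjes_measure_density) (use f_nonneg f_int zero in auto)
  moreover have "stieltjes_measure ?N"
    by (rule stieltjes_measure_density) (use g_nonneg g_int zero in auto)
  moreover have "same_moments (tau c) ?N"
    unfolding same_moments_def
  proof
    fix n
    have "(\<integral>t. t ^ n \<partial>?N) = (\<integral>t. g t * t ^ n \<partial>lborel)"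
      using g_nonneg by (subst integral_density) auto
    also have "\<dots> = (\<integral>t. f t * t ^ n \<partial>lborel)"
      unfolding g_eq using f_int[of n] h_int[of n] h_val[of n] by simp
    also have "\<dots> = (\<integral>t. t ^ n \<partial>tau c)"
      unfolding tau using f_nonneg by (subst integral_density) auto
    finally show "(\<integral>t. t ^ n \<partial>tau c) = (\<integral>t. t ^ n \<partial>?N)" ..
  qed
  moreover have "?N \<noteq> tau c"
  proof
    assume "?N = tau c"
    hence "AE t in lborel. ennreal (g t) = ennreal (f t)"
      unfolding tau by (intro sigma_finite_measure.density_unique[OF sigma_finite_lborel]) auto
    \<comment> \<open>Both densities are nonnegative, so equality in \<open>ennreal\<close> is
      equality of the real values, and \<delta> > 0 leaves h = 0.\<close>
    hence "AE t in lborel. h t = 0"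
      using f_nonneg g_nonneg \<delta> by (auto elim!: eventually_mono simp: g_def)
    with oscillation_not_AE_zero[OF \<alpha>(1,2) K(1)] show False by (simp add: h_def)
  qed
  ultimately show ?thesis unfolding S_indeterminate_def by blast
qed

end
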